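(* Let $((X^n(t))_{t\in[0,T]})_{n\in\mathbb{N}}$ be a family of $p$-dimensional, continuous, centered Gaussian processes, starting from zero, with independent components, which satisfies an LDP on $C([0,T],\mathbb{R}^p)$ with speed $\gamma_n$ and good rate function $$I(h)=\sum_{i=1}^p I_i(h_i),\qquad I_i(h_i)=\begin{cases}\frac12\|h_i\|^2_{\mathscr{H}_i} & h_i\in\mathscr{H}_i\\ +\infty & h_i\notin\mathscr{H}_i,\end{cases}$$ where $\mathscr{H}_i\subset C([0,T],\mathbb{R})$ is the reproducing kernel Hilbert space associated to some covariance function $k_{ii}$. Let $(\widetilde A^n)_{n\in\mathbb{N}}$ be a family of positive random variables, independent of $(X^n)_{n\in\mathbb{N}}$, satisfying the LDP on $[0,+\infty)$ with speed $\gamma_n$ and good rate function $x\mapsto dx^\theta$ ($x\ge0$) for some $d,\theta>0$. Let $\hat b=(\hat b_1,\ldots,\hat b_p)\in C([0,T],\mathbb{R}^p)$ and $$Z^n(t)=\widetilde A^nX^n(t)+\hat b(t)\quad(t\in[0,T]).$$ Let $x_1,\ldots,x_p>0$ be such that $x_i-\hat b_i(t)>0$ for every $t\in[0,T]$ and $i=1,\ldots,p$. Set $$p_n:=\mathbb{P}\Big(\bigcap_{i=1}^p\Big\{\sup_{t\in[0,T]}Z^n_i(t)\ge x_i\Big\}\Big).$$ Then $$\lim_{n\to+\infty}\frac1{\gamma_n}\log(p_n)=-w_Q^{(=)},\qquad w_Q^{(=)}:=\psi(d,\theta)\inf_{t_1,\ldots,t_p\in[0,T]}\left[\frac12\sum_{i=1}^p\frac{(-\hat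 b_i(t_i)+x_i)^2}{k_{ii}(t_i,t_i)}\right]^{\theta/(\theta+2)}.$$
   Context: $T>0$ and $p\ge1$ are fixed; $C([0,T],\mathbb{R}^p)$ carries the sup-norm. For $d,\theta>0$, $$\psi(d,\theta):=2^{\theta/(\theta+2)}\Big(d(d\theta)^{-\theta/(\theta+2)}+\frac12(d\theta)^{2/(\theta+2)}\Big).$$ Quotients with positive numerator and zero denominator (e.g. at $t_i=0$, where $k_{ii}(0,0)=0$) are read as $+\infty$; a positive power of $+\infty$ is $+\infty$; $\log 0=-\infty$. Large deviation principle (LDP): let $E$ be a topological space with Borel $\sigma$-algebra and $\gamma_n>0$ with $\gamma_n\to+\infty$ (the speed). A rate function is a lower semicontinuous $I:E\to[0,+\infty]$; it is good if $\{I\le a\}$ is compact for all $a\ge0$. Probability measures $(\mu_n)$ satisfy the LDP on $E$ with rate function $I$ and speed $\gamma_n$ if $\liminf_n\frac1{\gamma_n}\log\mu_n(\Theta)\ge-\inf_{x\in\Theta}I(x)$ for every open $\Theta$ and $\limsup_n\frac1{\gamma_n}\log\mu_n(\Gamma)\le-\inf_{x\in\Gamma}I(x)$ for every closed $\Gamma$. Random elements satisfy an LDP if their laws do. Reproducing kernel Hilbert space (RKHS): let $U=(U(t))_{t\in[0,T]}$ be a real continuous centered Gaussian process with covariance function $k$. Let $H$ be the $L^2$-closure of $\{\int_0^TU(t)\,d\lambda(t):\lambda\text{ a signed measure on }[0,T]\}$. The RKHS of $k$ is $\mathscr{H}=\{h: h(t)=\mathbb{E}[U(t)Y],\ Y\in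 H\}\subset C([0,T],\mathbb{R})$, with inner product transported from $L^2$ by the bijection $Y\mapsto\mathbb{E}[U(\cdot)Y]$. Equivalently it is the completion of the functions $x(t)=\int_0^Tk(t,s)\,d\lambda(s)$ under $\|x\|^2=\int_0^T\int_0^Tk(t,s)\,d\lambda(t)\,d\lambda(s)$. *)

theory Defs
  imports "HOL-Probability.Probability"
begin

section \<open>Large deviation principles\<close>

definition borel_on :: "'a topology \<Rightarrow> 'a measure" where
  "borel_on E = sigma (topspace E) {U. openin E U}"

definition ereal_ln :: "real \<Rightarrow> ereal" where
  "ereal_ln x = (if x = 0 then -\<infinity> else ereal (ln x))"

text \<open>Lower semicontinuity is expressed by closedness of the sublevel sets.\<close>

definition rate_function :: "'a topology \<Rightarrow> ('a \<Rightarrow> ereal) \<Rightarrow> bool" where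
  "rate_function E I \<longleftrightarrow>
     (\<forall>x\<in>topspace E. 0 \<le> I x) \<and>
     (\<forall>a::real. closedin E {x \<in> topspace E. I x \<le> ereal a})"

definition good_rate_function :: "'a topology \<Rightarrow> ('a \<Rightarrow> ereal) \<Rightarrow> bool" where
  "good_rate_function E I \<longleftrightarrow>
     rate_function E I \<and>
     (\<forall>a::real. 0 \<le> a \<longrightarrow> compactin E {x \<in> topspace E. I x \<le> ereal a})"

definition speed :: "(nat \<Rightarrow> real) \<Rightarrow> bool" where
  "speed \<gamma> \<longleftrightarrow> (\<forall>n. 0 < \<gamma> n) \<and> filterlim \<gamma> at_top sequentially"

definition LDP ::
  "'a topology \<Rightarrow> (nat \<Rightarrow> 'a measure) \<Rightarrow> (nat \<Rightarrow> real) \<Rightarrow> ('a \<Rightarrow> ereal) \<Rightarrow> bool" where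
  "LDP E \<mu> \<gamma> I \<longleftrightarrow>
     speed \<gamma> \<and> rate_function E I \<and>
     (\<forall>n. prob_space (\<mu> n) \<and> sets (\<mu> n) = sets (borel_on E)) \<and>
     (\<forall>\<Theta>. openin E \<Theta> \<longrightarrow>
        liminf (\<lambda>n. ereal_ln (measure (\<mu> n) \<Theta>) / ereal (\<gamma> n)) \<ge> - (INF x\<in>\<Theta>. I x)) \<and>
     (\<forall>\<Gamma>. closedin E \<Gamma> \<longrightarrow>
        limsup (\<lambda>n. ereal_ln (measure (\<mu> n) \<Gamma>) / ereal (\<gamma> n)) \<le> - (INF x\<in>\<Gamma>. I x))"

definition LDP_elements ::
  "'w measure \<Rightarrow> 'a topology \<Rightarrow> (nat \<Rightarrow> 'w \<Rightarrow> 'a) \<Rightarrow> (nat \<Rightarrow> real) \<Rightarrow> ('a \<Rightarrow> ereal) \<Rightarrow> bool" where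
  "LDP_elements M E Y \<gamma> I \<longleftrightarrow>
     (\<forall>n. Y n \<in> M \<rightarrow>\<^sub>M borel_on E) \<and>
     LDP E (\<lambda>n. distr M (borel_on E) (Y n)) \<gamma> I"


section \<open>Continuous Gaussian processes on a compact interval\<close>

text \<open>The sup-norm topology. The points are the continuous functions on \<open>{0..T}\<close>,
  extended by \<open>undefined\<close> outside the interval.\<close>

definition C_space :: "real \<Rightarrow> (real \<Rightarrow> 'a::metric_space) topology" where
  "C_space T = mtopology_of (cfunspace (top_of_set {0..T}) euclidean_metric)"

definition trajectory :: "real \<Rightarrow> (real \<Rightarrow> 'w \<Rightarrow> 'a) \<Rightarrow> 'w \<Rightarrow> real \<Rightarrow> 'a" where
  "trajectory T X \<omega> = (\<lambda>t\<in>{0..T}. X t \<omega>)"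

definition continuous_process ::
  "'w measure \<Rightarrow> real \<Rightarrow> (real \<Rightarrow> 'w \<Rightarrow> 'a::topological_space) \<Rightarrow> bool" where
  "continuous_process M T X \<longleftrightarrow>
     (\<forall>t\<in>{0..T}. X t \<in> borel_measurable M) \<and>
     (\<forall>\<omega>\<in>space M. continuous_on {0..T} (\<lambda>t. X t \<omega>))"

text \<open>The value \<open>\<sigma> = 0\<close> is the degenerate case.\<close>

definition centered_normal :: "'w measure \<Rightarrow> ('w \<Rightarrow> real) \<Rightarrow> bool" where
  "centered_normal M Y \<longleftrightarrow>
     Y \<in> borel_measurable M \<and>
     (\<exists>\<sigma>\<ge>0. distr M borel Y =
        (if \<sigma> = 0 then return borel 0 else density lborel (\<lambda>x. ennreal (normal_density 0 \<sigma> x))))"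

text \<open>For vector-valued processes, the coefficient vectors \<open>c t\<close> range over all linear
  combinations of the components at finitely many times.\<close>

definition centered_gaussian_process ::
  "'w measure \<Rightarrow> real \<Rightarrow> (real \<Rightarrow> 'w \<Rightarrow> 'a::euclidean_space) \<Rightarrow> bool" where
  "centered_gaussian_process M T X \<longleftrightarrow>
     (\<forall>t\<in>{0..T}. X t \<in> borel_measurable M) \<and>
     (\<forall>F c. finite F \<and> F \<subseteq> {0..T} \<longrightarrow> centered_normal M (\<lambda>\<omega>. \<Sum>t\<in>F. c t \<bullet> X t \<omega>))"

text \<open>Independence of two random elements with possibly different value types;
  \<open>indep_var\<close> needs a common one.\<close>

definition indep_elements ::
  "'w measure \<Rightarrow> 'a measure \<Rightarrow> ('w \<Rightarrow> 'a) \<Rightarrow> 'b measure \<Rightarrow> ('w \<Rightarrow> 'b) \<Rightarrow> bool" where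
  "indep_elements M S X S' Y \<longleftrightarrow>
     X \<in> M \<rightarrow>\<^sub>M S \<and> Y \<in> M \<rightarrow>\<^sub>M S' \<and>
     prob_space.indep_set M (sets (vimage_algebra (space M) X S))
       (sets (vimage_algebra (space M) Y S'))"


section \<open>The reproducing kernel Hilbert space\<close>

definition finite_borel_measure :: "real \<Rightarrow> real measure \<Rightarrow> bool" where
  "finite_borel_measure T \<alpha> \<longleftrightarrow>
     finite_measure \<alpha> \<and> sets \<alpha> = sets (restrict_space borel {0..T})"

text \<open>The signed measures on \<open>[0,T]\<close> are the differences of two finite positive measures
  (Jordan decomposition), and the integral against a signed measure is the difference of the
  two integrals.\<close>

definition signed_integrals :: "real \<Rightarrow> (real \<Rightarrow> 'v \<Rightarrow> real) \<Rightarrow> ('v \<Rightarrow> real) set" where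
  "signed_integrals T U =
     {(\<lambda>\<omega>. (\<integral>t. U t \<omega> \<partial>\<alpha>) - (\<integral>t. U t \<omega> \<partial>\<beta>)) | \<alpha> \<beta>.
        finite_borel_measure T \<alpha> \<and> finite_borel_measure T \<beta>}"

text \<open>The closure in \<open>L\<^sup>2\<close>, consisting of representatives rather than almost-everywhere
  classes.\<close>

definition L2_closure :: "'v measure \<Rightarrow> ('v \<Rightarrow> real) set \<Rightarrow> ('v \<Rightarrow> real) set" where
  "L2_closure N L =
     {Y \<in> borel_measurable N. integrable N (\<lambda>\<omega>. (Y \<omega>)\<^sup>2) \<and>
        (\<forall>\<epsilon>>0. \<exists>V\<in>L. (\<integral>\<^sup>+\<omega>. ennreal ((Y \<omega> - V \<omega>)\<^sup>2) \<partial>N) < ennreal \<epsilon>)}"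

definition gaussian_space :: "'v measure \<Rightarrow> real \<Rightarrow> (real \<Rightarrow> 'v \<Rightarrow> real) \<Rightarrow> ('v \<Rightarrow> real) set" where
  "gaussian_space N T U = L2_closure N (signed_integrals T U)"

definition rkhs_map ::
  "'v measure \<Rightarrow> real \<Rightarrow> (real \<Rightarrow> 'v \<Rightarrow> real) \<Rightarrow> ('v \<Rightarrow> real) \<Rightarrow> real \<Rightarrow> real" where
  "rkhs_map N T U Y = (\<lambda>t\<in>{0..T}. \<integral>\<omega>. U t \<omega> * Y \<omega> \<partial>N)"

definition rkhs :: "'v measure \<Rightarrow> real \<Rightarrow> (real \<Rightarrow> 'v \<Rightarrow> real) \<Rightarrow> (real \<Rightarrow> real) set" where
  "rkhs N T U = rkhs_map N T U ` gaussian_space N T U"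

text \<open>The map \<open>rkhs_map\<close> is injective on the Gaussian space up to almost-everywhere equality,
  so the choice of the preimage does not affect the inner product.\<close>

definition rkhs_inner ::
  "'v measure \<Rightarrow> real \<Rightarrow> (real \<Rightarrow> 'v \<Rightarrow> real) \<Rightarrow> (real \<Rightarrow> real) \<Rightarrow> (real \<Rightarrow> real) \<Rightarrow> real" where
  "rkhs_inner N T U g h =
     (let \<Phi>inv = inv_into (gaussian_space N T U) (rkhs_map N T U)
      in \<integral>\<omega>. \<Phi>inv g \<omega> * \<Phi>inv h \<omega> \<partial>N)"

definition rkhs_norm :: "'v measure \<Rightarrow> real \<Rightarrow> (real \<Rightarrow> 'v \<Rightarrow> real) \<Rightarrow> (real \<Rightarrow> real) \<Rightarrow> real" where
  "rkhs_norm N T U h = sqrt (rkhs_inner N T U h h)"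

definition rkhs_rate :: "'v measure \<Rightarrow> real \<Rightarrow> (real \<Rightarrow> 'v \<Rightarrow> real) \<Rightarrow> (real \<Rightarrow> real) \<Rightarrow> ereal" where
  "rkhs_rate N T U h =
     (if h \<in> rkhs N T U then ereal (1 / 2 * (rkhs_norm N T U h)\<^sup>2) else \<infinity>)"


section \<open>The constants in the limit\<close>

definition psi :: "real \<Rightarrow> real \<Rightarrow> real" where
  "psi d \<theta> = 2 powr (\<theta> / (\<theta> + 2)) *
     (d * (d * \<theta>) powr (- \<theta> / (\<theta> + 2)) + 1 / 2 * (d * \<theta>) powr (2 / (\<theta> + 2)))"

text \<open>Only meant for nonnegative bases and positive exponents.\<close>

definition ereal_powr :: "ereal \<Rightarrow> real \<Rightarrow> ereal" where
  "ereal_powr x a = (if x = \<infinity> then \<infinity> else ereal (real_of_ereal x powr a))"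

text \<open>The quotients are taken in \<open>ereal\<close>, where a positive number divided by \<open>0\<close>
  is \<open>\<infinity>\<close>.\<close>

definition w_Q ::
  "real \<Rightarrow> real \<Rightarrow> real \<Rightarrow> ('p::finite \<Rightarrow> real \<Rightarrow> real \<Rightarrow> real) \<Rightarrow> (real \<Rightarrow> real ^ 'p) \<Rightarrow>
   ('p \<Rightarrow> real) \<Rightarrow> ereal" where
  "w_Q T d \<theta> k b x =
     ereal (psi d \<theta>) *
     (INF t\<in>{t :: 'p \<Rightarrow> real. \<forall>i. t i \<in> {0..T}}.
        ereal_powr
          (ereal (1 / 2) *
            (\<Sum>i\<in>UNIV. ereal ((- (b (t i) $ i) + x i)\<^sup>2) / ereal (k i (t i) (t i))))
          (\<theta> / (\<theta> + 2)))"

end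

theory Submission
  imports Defs
begin

text \<open>
  Write \<open>c\<^sub>i(t) = x\<^sub>i - b\<^sub>i(t) > 0\<close>. Since the suprema are attained and \<open>A\<^sub>n > 0\<close>, every component
  of \<open>Z\<^sup>n\<close> reaches its threshold exactly when \<open>A\<^sub>n W\<^sub>n \<ge> 1\<close>, where
  \<open>W\<^sub>n = min\<^sub>i sup\<^sub>t X\<^sup>n\<^sub>i(t) / c\<^sub>i(t)\<close> is a continuous functional of the path. The theorem is thus
  about the tail of a product of two independent real variables, and it needs only the tails of
  the factors.

  The tail of \<open>W\<^sub>n\<close>: by the LDP, \<open>W\<^sub>n \<ge> w\<close> costs the infimum of the rate over paths with
  \<open>h\<^sub>i(t\<^sub>i) \<ge> w c\<^sub>i(t\<^sub>i)\<close> for some times \<open>t\<^sub>i\<close>. In the reproducing kernel Hilbert space a function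
  with \<open>h(t) \<ge> a > 0\<close> costs at least \<open>a\<^sup>2 / (2 k(t,t))\<close> by Cauchy-Schwarz
  (\<open>rkhs_rate_lower_bound\<close>), and a multiple of \<open>k(\<cdot>,t)\<close> attains this value
  (\<open>rkhs_rate_upper_bound\<close>). So the cost is \<open>w\<^sup>2 J\<close> with
  \<open>J = inf\<^sub>t 1/2 \<Sum>\<^sub>i c\<^sub>i(t\<^sub>i)\<^sup>2 / k\<^sub>i\<^sub>i(t\<^sub>i,t\<^sub>i)\<close>, and \<open>0 < J \<le> \<infinity>\<close>
  (\<open>path_rate_ge\<close>, \<open>path_rate_near_min\<close>, \<open>min_hitting_cost_pos\<close>).

  The tail of the product (\<open>tail_of_product\<close>): if \<open>A\<^sub>n \<approx> a\<close> then \<open>W\<^sub>n \<ge> 1/a\<close> is needed, which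
  together costs \<open>d a\<^sup>\<theta> + J/a\<^sup>2\<close>. For each \<open>a\<close> independence turns this into a lower bound for the
  probability. For the upper bound the possible values of \<open>A\<^sub>n\<close> are covered by finitely many cells
  of a geometric grid, and on the exponential scale the largest of finitely many terms decides.
  Minimising over \<open>a\<close> gives \<open>\<psi>(d,\<theta>) J\<^bsup>\<theta>/(\<theta>+2)\<^esup>\<close> (\<open>power_plus_inverse_square_minimum\<close>).

  Two points about the Hilbert space need care. A competitor path must be continuous; this follows
  from \<open>L\<^sup>2\<close>-continuity of the Gaussian process, because for centered normal variables
  \<open>E cos Y = exp(- E Y\<^sup>2 / 2)\<close>, so that bounded convergence of the cosine controls the variance. And
  the norm is computed from an arbitrary preimage under the map to the Hilbert space; two preimages
  differ by a variable orthogonal to all \<open>U\<^sub>t\<close>, hence by Fubini orthogonal to the whole Gaussian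
  space (\<open>orthogonal_to_gaussian_space\<close>), and so have the same norm.
\<close>

section \<open>Probabilities on the exponential scale\<close>

text \<open>These are the logarithmic bounds \<open>limsup (ln q\<^sub>n) / \<gamma>\<^sub>n \<le> -R\<close> and
  \<open>liminf (ln q\<^sub>n) / \<gamma>\<^sub>n \<ge> -R\<close>, phrased without logarithms so that sums and products of
  probabilities can be estimated directly.\<close>
definition exp_upper :: "(nat \<Rightarrow> real) \<Rightarrow> (nat \<Rightarrow> real) \<Rightarrow> ereal \<Rightarrow> bool" where
  "exp_upper \<gamma> q R \<longleftrightarrow>
     (\<forall>L::real. ereal L < R \<longrightarrow> (\<forall>\<^sub>F n in sequentially. q n \<le> exp (- L * \<gamma> n)))"

definition exp_lower :: "(nat \<Rightarrow> real) \<Rightarrow> (nat \<Rightarrow> real) \<Rightarrow> ereal \<Rightarrow> bool" where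
  "exp_lower \<gamma> q R \<longleftrightarrow>
     (\<forall>L::real. R < ereal L \<longrightarrow> (\<forall>\<^sub>F n in sequentially. exp (- L * \<gamma> n) \<le> q n))"

lemma ereal_ln_div_less_iff:
  assumes "0 < g" "0 \<le> q"
  shows "ereal_ln q / ereal g < ereal (- L) \<longleftrightarrow> q < exp (- L * g)"
proof (cases "q = 0")
  case True
  then show ?thesis using assms by (simp add: ereal_ln_def)
next
  case False
  then have q: "q > 0" using assms by simp
  have "ereal_ln q / ereal g < ereal (- L) \<longleftrightarrow> ln q / g < - L"
    using False assms by (simp add: ereal_ln_def)
  also have "\<dots> \<longleftrightarrow> ln q < - L * g"
    using assms by (simp add: pos_divide_less_eq)
  also have "\<dots> \<longleftrightarrow> q < exp (- L * g)"
    using q by (metis exp_less_cancel_iff exp_ln)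
  finally show ?thesis .
qed

lemma ereal_less_ln_div_iff:
  assumes "0 < g" "0 \<le> q"
  shows "ereal (- L) < ereal_ln q / ereal g \<longleftrightarrow> exp (- L * g) < q"
proof (cases "q = 0")
  case True
  then show ?thesis using assms by (simp add: ereal_ln_def)
next
  case False
  then have q: "q > 0" using assms by simp
  have "ereal (- L) < ereal_ln q / ereal g \<longleftrightarrow> - L < ln q / g"
    using False assms by (simp add: ereal_ln_def)
  also have "\<dots> \<longleftrightarrow> - L * g < ln q"
    using assms by (simp add: pos_less_divide_eq)
  also have "\<dots> \<longleftrightarrow> exp (- L * g) < q"
    using q by (metis exp_less_cancel_iff exp_ln)
  finally show ?thesis .
qed

lemma exp_upper_if_limsup:
  assumes \<gamma>: "\<And>n. 0 < \<gamma> n" and q: "\<And>n. 0 \<le> q n"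
    and le: "limsup (\<lambda>n. ereal_ln (q n) / ereal (\<gamma> n)) \<le> - R"
  shows "exp_upper \<gamma> q R"
  unfolding exp_upper_def
proof (intro allI impI)
  fix L assume "ereal L < R"
  then have "- R < ereal (- L)" by (metis ereal_minus_less_minus uminus_ereal.simps(1))
  then have "limsup (\<lambda>n. ereal_ln (q n) / ereal (\<gamma> n)) < ereal (- L)"
    using le by simp
  from Limsup_lessD[OF this] show "\<forall>\<^sub>F n in sequentially. q n \<le> exp (- L * \<gamma> n)"
    by (rule eventually_mono) (use ereal_ln_div_less_iff[OF \<gamma> q] in force)
qed

lemma exp_lower_if_liminf:
  assumes \<gamma>: "\<And>n. 0 < \<gamma> n" and q: "\<And>n. 0 \<le> q n"
    and le: "- R \<le> liminf (\<lambda>n. ereal_ln (q n) / ereal (\<gamma> n))"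
  shows "exp_lower \<gamma> q R"
  unfolding exp_lower_def
proof (intro allI impI)
  fix L assume "R < ereal L"
  then have "ereal (- L) < - R" by (metis ereal_minus_less_minus uminus_ereal.simps(1))
  then have "ereal (- L) < liminf (\<lambda>n. ereal_ln (q n) / ereal (\<gamma> n))"
    using le by simp
  from less_LiminfD[OF this] show "\<forall>\<^sub>F n in sequentially. exp (- L * \<gamma> n) \<le> q n"
    by (rule eventually_mono) (use ereal_less_ln_div_iff[OF \<gamma> q] in force)
qed

lemma ln_div_tendsto_if_exp_bounds:
  assumes \<gamma>: "\<And>n. 0 < \<gamma> n" and q: "\<And>n. 0 \<le> q n"
    and up: "exp_upper \<gamma> q R" and lo: "exp_lower \<gamma> q R"
  shows "(\<lambda>n. ereal_ln (q n) / ereal (\<gamma> n)) \<longlonglongrightarrow> - R"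
proof (rule order_tendstoI)
  fix a assume "a < - R"
  then have "R < - a" by (simp add: ereal_less_uminus_reorder)
  then obtain L L' where L: "R < ereal L" "ereal L < ereal L'" "ereal L' < - a"
    using ereal_dense2 by metis
  have "\<forall>\<^sub>F n in sequentially. exp (- L * \<gamma> n) \<le> q n"
    using lo L(1) by (auto simp: exp_lower_def)
  then show "\<forall>\<^sub>F n in sequentially. a < ereal_ln (q n) / ereal (\<gamma> n)"
  proof (rule eventually_mono)
    fix n assume "exp (- L * \<gamma> n) \<le> q n"
    moreover have "exp (- L' * \<gamma> n) < exp (- L * \<gamma> n)"
      using L(2) \<gamma>[of n] by simp
    ultimately have "ereal (- L') < ereal_ln (q n) / ereal (\<gamma> n)"
      using ereal_less_ln_div_iff[OF \<gamma>[of n] q[of n], of L'] by linarith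
    moreover have "a < ereal (- L')"
      using L(3) by (metis ereal_less_uminus_reorder uminus_ereal.simps(1))
    ultimately show "a < ereal_ln (q n) / ereal (\<gamma> n)" by order
  qed
next
  fix a assume "- R < a"
  then have "- a < R" by (simp add: ereal_uminus_less_reorder)
  then obtain L L' where L: "- a < ereal L'" "ereal L' < ereal L" "ereal L < R"
    using ereal_dense2 by metis
  have "\<forall>\<^sub>F n in sequentially. q n \<le> exp (- L * \<gamma> n)"
    using up L(3) by (auto simp: exp_upper_def)
  then show "\<forall>\<^sub>F n in sequentially. ereal_ln (q n) / ereal (\<gamma> n) < a"
  proof (rule eventually_mono)
    fix n assume "q n \<le> exp (- L * \<gamma> n)"
    moreover have "exp (- L * \<gamma> n) < exp (- L' * \<gamma> n)"
      using L(2) \<gamma>[of n] by simp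
    ultimately have "ereal_ln (q n) / ereal (\<gamma> n) < ereal (- L')"
      using ereal_ln_div_less_iff[OF \<gamma>[of n] q[of n], of L'] by linarith
    moreover have "ereal (- L') < a"
      using L(1) by (metis ereal_uminus_less_reorder uminus_ereal.simps(1))
    ultimately show "ereal_ln (q n) / ereal (\<gamma> n) < a" by order
  qed
qed

lemma exp_upper_antimono: "exp_upper \<gamma> q R \<Longrightarrow> R' \<le> R \<Longrightarrow> exp_upper \<gamma> q R'"
  unfolding exp_upper_def by (metis order_less_le_trans)

lemma exp_lower_mono: "exp_lower \<gamma> q R \<Longrightarrow> R \<le> R' \<Longrightarrow> exp_lower \<gamma> q R'"
  unfolding exp_lower_def by (metis order_le_less_trans)

lemma exp_lower_increase: "exp_lower \<gamma> q R \<Longrightarrow> (\<And>n. q n \<le> q' n) \<Longrightarrow> exp_lower \<gamma> q' R"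
  unfolding exp_lower_def by (metis (mono_tags, lifting) eventually_mono order_trans)

lemma ereal_less_add_split:
  assumes "ereal L < ereal a + R"
  obtains L' where "ereal L' < R" "L < a + L'"
proof -
  have "ereal (L - a) < R"
    using assms by (cases R) auto
  then obtain L' where "ereal (L - a) < ereal L'" "ereal L' < R"
    using ereal_dense2 by blast
  then show ?thesis using that by force
qed

lemma exp_upper_mult:
  assumes nonneg: "\<And>n. 0 \<le> q n" "\<And>n. 0 \<le> q' n"
    and "exp_upper \<gamma> q (ereal a)" "exp_upper \<gamma> q' R"
  shows "exp_upper \<gamma> (\<lambda>n. q n * q' n) (ereal a + R)"
  unfolding exp_upper_def
proof (intro allI impI)
  fix L assume "ereal L < ereal a + R"
  then obtain L' where L': "ereal L' < R" "L < a + L'"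
    by (rule ereal_less_add_split)
  then have "ereal (L - L') < ereal a"
    by simp
  then have "\<forall>\<^sub>F n in sequentially. q n \<le> exp (- (L - L') * \<gamma> n)"
    "\<forall>\<^sub>F n in sequentially. q' n \<le> exp (- L' * \<gamma> n)"
    using assms(3,4) L'(1) unfolding exp_upper_def by blast+
  then show "\<forall>\<^sub>F n in sequentially. q n * q' n \<le> exp (- L * \<gamma> n)"
  proof eventually_elim
    case (elim n)
    have "q n * q' n \<le> exp (- (L - L') * \<gamma> n) * exp (- L' * \<gamma> n)"
      using elim nonneg by (intro mult_mono) auto
    also have "\<dots> = exp (- L * \<gamma> n)"
      by (simp add: exp_add[symmetric] algebra_simps)
    finally show ?case .
  qed
qed

lemma exp_lower_mult:
  assumes nonneg: "\<And>n. 0 \<le> q' n"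
    and "exp_lower \<gamma> q (ereal a)" "exp_lower \<gamma> q' (ereal c)"
  shows "exp_lower \<gamma> (\<lambda>n. q n * q' n) (ereal (a + c))"
  unfolding exp_lower_def
proof (intro allI impI)
  fix L assume "ereal (a + c) < ereal L"
  then have L: "a + c < L" by simp
  define e where "e = (L - a - c) / 2"
  have "a < a + e" "c < c + e" "L = (a + e) + (c + e)"
    using L by (auto simp: e_def field_simps)
  note e = this
  have "\<forall>\<^sub>F n in sequentially. exp (- (a + e) * \<gamma> n) \<le> q n"
    "\<forall>\<^sub>F n in sequentially. exp (- (c + e) * \<gamma> n) \<le> q' n"
    using assms(2,3) e(1,2) unfolding exp_lower_def by (metis less_ereal.simps(1))+
  then show "\<forall>\<^sub>F n in sequentially. exp (- L * \<gamma> n) \<le> q n * q' n"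
  proof eventually_elim
    case (elim n)
    have "exp (- L * \<gamma> n) = exp (- (a + e) * \<gamma> n) * exp (- (c + e) * \<gamma> n)"
      by (simp add: exp_add[symmetric] e(3) algebra_simps)
    also have "\<dots> \<le> q n * q' n"
      using elim nonneg by (intro mult_mono) (auto intro: order_trans[OF exp_ge_zero])
    finally show ?case .
  qed
qed

text \<open>A sum with a fixed number of terms costs only a constant factor, which any loss in the exponent
  absorbs because the speed tends to infinity.\<close>
lemma exp_upper_sum:
  assumes \<gamma>: "filterlim \<gamma> at_top sequentially" and "finite J"
    and up: "\<And>j. j \<in> J \<Longrightarrow> exp_upper \<gamma> (q j) R"
    and le: "\<And>n. q' n \<le> (\<Sum>j\<in>J. q j n)"
  shows "exp_upper \<gamma> q' R"
  unfolding exp_upper_def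
proof (intro allI impI)
  fix L assume "ereal L < R"
  then obtain L' where "ereal L < ereal L'" and L'R: "ereal L' < R"
    using ereal_dense2 by blast
  then have LL': "L < L'" by simp
  have "\<forall>\<^sub>F n in sequentially. \<forall>j\<in>J. q j n \<le> exp (- L' * \<gamma> n)"
    using up L'R \<open>finite J\<close> by (subst eventually_ball_finite_distrib) (auto simp: exp_upper_def)
  moreover have "\<forall>\<^sub>F n in sequentially. ln (real (card J) + 1) / (L' - L) \<le> \<gamma> n"
    using \<gamma> by (auto simp: filterlim_at_top)
  ultimately show "\<forall>\<^sub>F n in sequentially. q' n \<le> exp (- L * \<gamma> n)"
  proof eventually_elim
    case (elim n)
    have "q' n \<le> (\<Sum>j\<in>J. exp (- L' * \<gamma> n))"
      using elim(1) le[of n] by (meson order_trans sum_mono)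
    also have "\<dots> \<le> (real (card J) + 1) * exp (- L' * \<gamma> n)"
      by (simp add: algebra_simps)
    also have "\<dots> \<le> exp ((L' - L) * \<gamma> n) * exp (- L' * \<gamma> n)"
    proof (rule mult_right_mono)
      have "ln (real (card J) + 1) \<le> (L' - L) * \<gamma> n"
        using elim(2) LL' by (simp add: pos_divide_le_eq mult.commute)
      then show "real (card J) + 1 \<le> exp ((L' - L) * \<gamma> n)"
        by (metis exp_le_cancel_iff exp_ln add_nonneg_pos of_nat_0_le_iff zero_less_one)
    qed simp
    also have "\<dots> = exp (- L * \<gamma> n)"
      by (simp add: exp_add[symmetric] algebra_simps)
    finally show ?case .
  qed
qed

lemma exp_upper_add:
  assumes \<gamma>: "filterlim \<gamma> at_top sequentially"
    and "exp_upper \<gamma> q R" "exp_upper \<gamma> q' R" "\<And>n. r n \<le> q n + q' n"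
  shows "exp_upper \<gamma> r R"
proof (rule exp_upper_sum[OF \<gamma>, of UNIV "\<lambda>c. if c then q else q'"])
  show "r n \<le> (\<Sum>c\<in>UNIV. (if c then q else q') n)" for n
    using assms(4)[of n] by (simp add: UNIV_bool)
qed (use assms in auto)

lemma space_borel_on [simp]: "space (borel_on E) = topspace E"
  by (simp add: borel_on_def space_measure_of_conv)

lemma openin_in_borel_on: "openin E S \<Longrightarrow> S \<in> sets (borel_on E)"
  unfolding borel_on_def by (subst sets_measure_of) (auto dest: openin_subset)

lemma closedin_in_borel_on:
  assumes "closedin E S"
  shows "S \<in> sets (borel_on E)"
proof -
  have "S = space (borel_on E) - (topspace E - S)"
    using closedin_subset[OF assms] by auto
  moreover have "topspace E - S \<in> sets (borel_on E)"
    using assms by (intro openin_in_borel_on) auto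
  ultimately show ?thesis by (metis sets.compl_sets)
qed

lemma LDP_elements_exp_upper:
  assumes "LDP_elements M E Y \<gamma> I" "closedin E S"
  shows "exp_upper \<gamma> (\<lambda>n. measure M {\<omega>\<in>space M. Y n \<omega> \<in> S}) (INF y\<in>S. I y)"
proof (rule exp_upper_if_limsup)
  have Y: "Y n \<in> M \<rightarrow>\<^sub>M borel_on E" for n
    using assms(1) by (simp add: LDP_elements_def)
  have eq: "measure (distr M (borel_on E) (Y n)) S = measure M {\<omega>\<in>space M. Y n \<omega> \<in> S}" for n
    using closedin_in_borel_on[OF assms(2)] by (simp add: measure_distr[OF Y] vimage_def Int_def conj_commute)
  have "limsup (\<lambda>n. ereal_ln (measure (distr M (borel_on E) (Y n)) S) / ereal (\<gamma> n)) \<le> - (INF y\<in>S. I y)"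
    using assms unfolding LDP_elements_def LDP_def by blast
  then show "limsup (\<lambda>n. ereal_ln (measure M {\<omega>\<in>space M. Y n \<omega> \<in> S}) / ereal (\<gamma> n)) \<le> - (INF y\<in>S. I y)"
    by (simp only: eq)
qed (use assms(1) in \<open>auto simp: LDP_elements_def LDP_def speed_def\<close>)

lemma LDP_elements_exp_lower:
  assumes "LDP_elements M E Y \<gamma> I" "openin E S"
  shows "exp_lower \<gamma> (\<lambda>n. measure M {\<omega>\<in>space M. Y n \<omega> \<in> S}) (INF y\<in>S. I y)"
proof (rule exp_lower_if_liminf)
  have Y: "Y n \<in> M \<rightarrow>\<^sub>M borel_on E" for n
    using assms(1) by (simp add: LDP_elements_def)
  have eq: "measure (distr M (borel_on E) (Y n)) S = measure M {\<omega>\<in>space M. Y n \<omega> \<in> S}" for n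
    using openin_in_borel_on[OF assms(2)] by (simp add: measure_distr[OF Y] vimage_def Int_def conj_commute)
  have "- (INF y\<in>S. I y) \<le> liminf (\<lambda>n. ereal_ln (measure (distr M (borel_on E) (Y n)) S) / ereal (\<gamma> n))"
    using assms unfolding LDP_elements_def LDP_def by blast
  then show "- (INF y\<in>S. I y) \<le> liminf (\<lambda>n. ereal_ln (measure M {\<omega>\<in>space M. Y n \<omega> \<in> S}) / ereal (\<gamma> n))"
    by (simp only: eq)
qed (use assms(1) in \<open>auto simp: LDP_elements_def LDP_def speed_def\<close>)

section \<open>The minimum of \<open>d a\<^sup>\<theta> + J / a\<^sup>2\<close>\<close>

lemma psi_pos: "0 < d \<Longrightarrow> 0 < \<theta> \<Longrightarrow> 0 < psi d \<theta>"
  unfolding psi_def by (intro mult_pos_pos add_pos_pos) auto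

text \<open>Put \<open>a = a\<^sub>0 e\<^sup>s\<close>, with \<open>a\<^sub>0\<close> the critical point. Both terms become multiples of exponentials in \<open>s\<close>;
  bounding each by its tangent at \<open>s = 0\<close>, the linear parts cancel, since this is what being critical
  says.\<close>
lemma power_plus_inverse_square_minimum:
  fixes d \<theta> J :: real
  assumes d: "d > 0" and \<theta>: "\<theta> > 0" and J: "J > 0"
  defines "R \<equiv> psi d \<theta> * J powr (\<theta> / (\<theta> + 2))"
  shows "\<And>a. a > 0 \<Longrightarrow> R \<le> d * a powr \<theta> + J / a\<^sup>2"
    and "\<exists>a>0. d * a powr \<theta> + J / a\<^sup>2 = R"
proof -
  define B where "B = 2 * J / (d * \<theta>)"
  define a0 where "a0 = B powr (1 / (\<theta> + 2))"
  define \<alpha> \<beta> where "\<alpha> = \<theta> / (\<theta> + 2)" and "\<beta> = 2 / (\<theta> + 2)"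
  have \<alpha>\<beta>: "\<alpha> = 1 - \<beta>"
    using \<theta> by (simp add: \<alpha>_def \<beta>_def field_simps)
  have B: "B > 0" using assms by (simp add: B_def)
  have a0: "a0 > 0" using B by (simp add: a0_def)
  have a0_powr: "a0 powr \<theta> = B powr \<alpha>"
    by (simp add: a0_def \<alpha>_def powr_powr)
  have "a0\<^sup>2 = a0 powr 2" using a0 by simp
  also have "\<dots> = B powr \<beta>"
    by (simp add: a0_def \<beta>_def powr_powr)
  finally have a0_sq: "a0\<^sup>2 = B powr \<beta>" .
  \<comment> \<open>the derivative of the cost vanishes at \<open>a0\<close>\<close>
  have balance: "d * \<theta> * a0 powr \<theta> = 2 * (J / a0\<^sup>2)"
  proof -
    have "d * \<theta> * (a0 powr \<theta> * a0\<^sup>2) = d * \<theta> * B"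
      using B by (simp add: a0_powr a0_sq powr_add[symmetric] \<alpha>\<beta>)
    then show ?thesis
      using a0 assms by (simp add: B_def field_simps)
  qed
  have total: "d * a0 powr \<theta> + J / a0\<^sup>2 = R"
  proof -
    have "d * a0 powr \<theta> = 2 powr \<alpha> * (d * (d * \<theta>) powr (- \<alpha>)) * J powr \<alpha>"
      using assms by (simp add: a0_powr B_def powr_divide powr_mult powr_minus field_simps)
    moreover have "J / a0\<^sup>2 = 2 powr \<alpha> * (1 / 2 * (d * \<theta>) powr \<beta>) * J powr \<alpha>"
      using assms by (simp add: a0_sq B_def \<alpha>\<beta> powr_divide powr_mult powr_diff field_simps)
    moreover have "R = 2 powr \<alpha> * (d * (d * \<theta>) powr (- \<alpha>)) * J powr \<alpha> +
        2 powr \<alpha> * (1 / 2 * (d * \<theta>) powr \<beta>) * J powr \<alpha>"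
      unfolding R_def psi_def by (simp add: \<alpha>_def \<beta>_def algebra_simps)
    ultimately show ?thesis by (simp only:)
  qed
  show "\<exists>a>0. d * a powr \<theta> + J / a\<^sup>2 = R"
    using a0 total by blast
  show "R \<le> d * a powr \<theta> + J / a\<^sup>2" if a: "a > 0" for a
  proof -
    define s where "s = ln (a / a0)"
    have a_eq: "a = a0 * exp s"
      using a a0 by (simp add: s_def)
    have "d * a powr \<theta> = d * a0 powr \<theta> * exp (\<theta> * s)"
      using a0 by (simp add: a_eq powr_mult exp_powr_real mult.commute)
    moreover have "J / a\<^sup>2 = J / a0\<^sup>2 * exp (- (2 * s))"
      by (simp add: a_eq power_mult_distrib exp_minus exp_double[symmetric] field_simps
          flip: exp_of_nat_mult)
    moreover have "d * a0 powr \<theta> * (1 + \<theta> * s) \<le> d * a0 powr \<theta> * exp (\<theta> * s)"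
      using d by (intro mult_left_mono exp_ge_add_one_self) auto
    moreover have "J / a0\<^sup>2 * (1 + - (2 * s)) \<le> J / a0\<^sup>2 * exp (- (2 * s))"
      using J by (intro mult_left_mono exp_ge_add_one_self) auto
    moreover have "P * (1 + \<theta> * s) + Q * (1 + - (2 * s)) = P + Q" if "\<theta> * P = 2 * Q" for P Q
      using that by algebra
    then have "d * a0 powr \<theta> * (1 + \<theta> * s) + J / a0\<^sup>2 * (1 + - (2 * s)) = R"
      using balance total by (metis mult.assoc mult.commute)
    ultimately show ?thesis by linarith
  qed
qed

lemma ereal_powr_nonneg: "0 \<le> ereal_powr y a"
  by (simp add: ereal_powr_def)

lemma ereal_powr_mono:
  assumes "0 \<le> y" "y \<le> z" "0 \<le> a"
  shows "ereal_powr y a \<le> ereal_powr z a"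
  using assms by (cases y; cases z) (auto simp: ereal_powr_def powr_mono2)

lemma ereal_powr_inverse:
  assumes "0 \<le> y" "0 < a"
  shows "ereal_powr (ereal_powr y a) (1 / a) = y"
  using assms by (cases y) (auto simp: ereal_powr_def powr_powr)

text \<open>The power commutes with infima because it is an order isomorphism of \<open>[0,\<infinity>]\<close>, with the power
  \<open>1/a\<close> as its inverse.\<close>
lemma ereal_powr_INF:
  assumes a: "0 < a" and Q: "\<And>t. t \<in> S \<Longrightarrow> 0 \<le> Q t"
  shows "(INF t\<in>S. ereal_powr (Q t) a) = ereal_powr (INF t\<in>S. Q t) a"
proof (rule antisym)
  let ?R = "INF t\<in>S. ereal_powr (Q t) a"
  have R: "0 \<le> ?R" by (intro INF_greatest ereal_powr_nonneg)
  have "ereal_powr ?R (1 / a) \<le> Q t" if t: "t \<in> S" for t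
  proof -
    have "ereal_powr ?R (1 / a) \<le> ereal_powr (ereal_powr (Q t) a) (1 / a)"
      using R a t by (intro ereal_powr_mono INF_lower) auto
    then show ?thesis using Q[OF t] a by (simp add: ereal_powr_inverse)
  qed
  then have "ereal_powr (ereal_powr ?R (1 / a)) a \<le> ereal_powr (INF t\<in>S. Q t) a"
    using a by (intro ereal_powr_mono INF_greatest ereal_powr_nonneg) auto
  then show "?R \<le> ereal_powr (INF t\<in>S. Q t) a"
    using ereal_powr_inverse[of ?R "1 / a"] R a by simp
  show "ereal_powr (INF t\<in>S. Q t) a \<le> ?R"
    using a Q by (intro INF_greatest ereal_powr_mono INF_lower) auto
qed

section \<open>Tail of a product of independent factors\<close>

lemma exists_grid_cell:
  fixes y :: "nat \<Rightarrow> real"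
  assumes "y 0 \<le> a" "a \<le> y m"
  shows "a = y 0 \<or> (\<exists>j<m. y j \<le> a \<and> a \<le> y (Suc j))"
  using assms
proof (induction m)
  case (Suc m)
  then show ?case
    by (cases "a \<le> y m") (auto intro: less_SucI)
qed auto

text \<open>Pushing \<open>A\<close> to the level \<open>a\<close> leaves the requirement \<open>W \<ge> 1/a\<close>; the limit is the cheapest such
  compromise. For the upper bound a cell \<open>y \<le> A \<le> r y\<close> of a geometric grid is charged
  \<open>d y\<^sup>\<theta> + J/(r y)\<^sup>2\<close>, which is at least \<open>1/r\<^sup>2\<close> times the cost at \<open>y\<close>; the grid is then refined by
  \<open>r \<rightarrow> 1\<close>.\<close>
lemma tail_of_product:
  fixes A W :: "nat \<Rightarrow> 'w \<Rightarrow> real" and J :: ereal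
  assumes M: "prob_space M" and \<gamma>_pos: "\<And>n. 0 < \<gamma> n" and \<gamma>: "filterlim \<gamma> at_top sequentially"
    and A: "\<And>n. A n \<in> borel_measurable M" and W: "\<And>n. W n \<in> borel_measurable M"
    and A_pos: "\<And>n \<omega>. \<omega> \<in> space M \<Longrightarrow> A n \<omega> > 0"
    and indep_ge: "\<And>n a w. measure M {\<omega>\<in>space M. a \<le> A n \<omega> \<and> w \<le> W n \<omega>} =
      measure M {\<omega>\<in>space M. a \<le> A n \<omega>} * measure M {\<omega>\<in>space M. w \<le> W n \<omega>}"
    and indep_gt: "\<And>n a w. measure M {\<omega>\<in>space M. a < A n \<omega> \<and> w < W n \<omega>} =
      measure M {\<omega>\<in>space M. a < A n \<omega>} * measure M {\<omega>\<in>space M. w < W n \<omega>}"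
    and d: "d > 0" and \<theta>: "\<theta> > 0" and J: "J > 0"
    and A_upper: "\<And>a. a > 0 \<Longrightarrow> exp_upper \<gamma> (\<lambda>n. measure M {\<omega>\<in>space M. a \<le> A n \<omega>}) (ereal (d * a powr \<theta>))"
    and A_lower: "\<And>a. a > 0 \<Longrightarrow> exp_lower \<gamma> (\<lambda>n. measure M {\<omega>\<in>space M. a < A n \<omega>}) (ereal (d * a powr \<theta>))"
    and W_upper: "\<And>w. w > 0 \<Longrightarrow> exp_upper \<gamma> (\<lambda>n. measure M {\<omega>\<in>space M. w \<le> W n \<omega>}) (ereal (w\<^sup>2) * J)"
    and W_lower: "\<And>w. w > 0 \<Longrightarrow> exp_lower \<gamma> (\<lambda>n. measure M {\<omega>\<in>space M. w < W n \<omega>}) (ereal (w\<^sup>2) * J)"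
  shows "(\<lambda>n. ereal_ln (measure M {\<omega>\<in>space M. 1 \<le> A n \<omega> * W n \<omega>}) / ereal (\<gamma> n))
           \<longlonglongrightarrow> - (ereal (psi d \<theta>) * ereal_powr J (\<theta> / (\<theta> + 2)))"
proof (rule ln_div_tendsto_if_exp_bounds)
  interpret prob_space M by (rule M)
  note [measurable] = A W
  let ?p = "\<lambda>n. prob {\<omega>\<in>space M. 1 \<le> A n \<omega> * W n \<omega>}"
  let ?R = "ereal (psi d \<theta>) * ereal_powr J (\<theta> / (\<theta> + 2))"
  show "0 < \<gamma> n" for n by (rule \<gamma>_pos)
  show "0 \<le> ?p n" for n by simp
  have W_large: "1 / a \<le> W n \<omega>" if "\<omega> \<in> space M" "1 \<le> A n \<omega> * W n \<omega>" "A n \<omega> \<le> a" for n \<omega> a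
  proof -
    have A0: "0 < A n \<omega>" using A_pos that(1) by simp
    have "1 / a \<le> 1 / A n \<omega>" using A0 that(3) by (simp add: frac_le)
    also have "\<dots> \<le> W n \<omega>" using A0 that(2) by (simp add: divide_le_eq mult.commute)
    finally show ?thesis .
  qed
  have psi: "0 < psi d \<theta>" using d \<theta> by (rule psi_pos)
  have "exp_upper \<gamma> ?p ?R \<and> exp_lower \<gamma> ?p ?R"
  proof (cases "J = \<infinity>")
    case True
    have "exp_upper \<gamma> ?p \<infinity>"
      unfolding exp_upper_def
    proof (intro allI impI)
      fix L :: real
      \<comment> \<open>every positive level of \<open>W\<close> has infinite cost, so only \<open>A \<ge> K\<close> matters, which costs more than \<open>L\<close>\<close>
      define K where "K = ((\<bar>L\<bar> + 1) / d) powr (1 / \<theta>)"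
      have K: "K > 0" "d * K powr \<theta> > L"
        using d \<theta> by (auto simp: K_def powr_powr)
      have "exp_upper \<gamma> ?p (ereal (d * K powr \<theta>))"
      proof (rule exp_upper_add[OF \<gamma> A_upper[OF K(1)]])
        show "exp_upper \<gamma> (\<lambda>n. prob {\<omega>\<in>space M. 1 / K \<le> W n \<omega>}) (ereal (d * K powr \<theta>))"
          using K(1) by (intro exp_upper_antimono[OF W_upper]) (auto simp: True)
        show "?p n \<le> prob {\<omega>\<in>space M. K \<le> A n \<omega>} + prob {\<omega>\<in>space M. 1 / K \<le> W n \<omega>}" for n
        proof -
          have "?p n \<le> prob ({\<omega>\<in>space M. K \<le> A n \<omega>} \<union> {\<omega>\<in>space M. 1 / K \<le> W n \<omega>})"
            using W_large[of _ n K] by (intro finite_measure_mono) force+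
          also have "\<dots> \<le> prob {\<omega>\<in>space M. K \<le> A n \<omega>} + prob {\<omega>\<in>space M. 1 / K \<le> W n \<omega>}"
            by (intro measure_Un_le) auto
          finally show ?thesis .
        qed
      qed
      then show "\<forall>\<^sub>F n in sequentially. ?p n \<le> exp (- L * \<gamma> n)"
        using K(2) by (auto simp: exp_upper_def)
    qed
    then show ?thesis
      using True psi by (simp add: ereal_powr_def exp_lower_def)
  next
    case False
    then obtain J' where J': "J = ereal J'" "J' > 0"
      using J by (cases J) auto
    define R where "R = psi d \<theta> * J' powr (\<theta> / (\<theta> + 2))"
    have R_eq: "?R = ereal R"
      by (simp add: J' R_def ereal_powr_def)
    have R: "R > 0" using psi J' by (simp add: R_def)
    note minimum = power_plus_inverse_square_minimum[OF d \<theta> J'(2), folded R_def]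
    \<comment> \<open>estimate from the geometric grid of ratio \<open>r\<close>\<close>
    have coarse: "exp_upper \<gamma> ?p (ereal (R / r\<^sup>2))" if r: "r > 1" for r
    proof -
      \<comment> \<open>below the grid \<open>W\<close> alone, and above it \<open>A\<close> alone, already costs at least \<open>R\<close>\<close>
      define a0 where "a0 = sqrt (J' / R)"
      have a0: "a0 > 0" "J' / a0\<^sup>2 = R"
        using R J' by (auto simp: a0_def)
      define y where "y = (\<lambda>j::nat. a0 * r ^ j)"
      have y: "y j > 0" "y (Suc j) = r * y j" for j
        using a0 r by (auto simp: y_def)
      obtain m where m: "(R / d) powr (1 / \<theta>) / a0 < r ^ m"
        using real_arch_pow[OF r] by blast
      have "(R / d) powr (1 / \<theta>) < y m"
        using m a0(1) by (simp add: y_def divide_less_eq mult.commute)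
      then have "((R / d) powr (1 / \<theta>)) powr \<theta> \<le> y m powr \<theta>"
        using \<theta> by (intro powr_mono2) auto
      then have m: "R \<le> d * y m powr \<theta>"
        using \<theta> R d by (simp add: powr_powr divide_le_eq mult.commute)
      have Rr: "R / r\<^sup>2 \<le> R"
        using r R by (simp add: divide_le_eq)
      let ?q = "\<lambda>j n. prob {\<omega>\<in>space M. y j \<le> A n \<omega> \<and> 1 / y (Suc j) \<le> W n \<omega>}"
      have cell: "exp_upper \<gamma> (?q j) (ereal (R / r\<^sup>2))" for j
      proof (rule exp_upper_antimono)
        show "exp_upper \<gamma> (?q j) (ereal (d * y j powr \<theta>) + ereal ((1 / y (Suc j))\<^sup>2) * J)"
          unfolding indep_ge
          using y(1) by (intro exp_upper_mult A_upper W_upper) auto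
        have "R / r\<^sup>2 \<le> (d * y j powr \<theta> + J' / (y j)\<^sup>2) / r\<^sup>2"
          using minimum(1)[OF y(1)[of j]] r by (simp add: divide_right_mono)
        also have "\<dots> = d * y j powr \<theta> / r\<^sup>2 + (1 / y (Suc j))\<^sup>2 * J'"
          using r y(1)[of j] unfolding y(2) by (simp add: field_simps power2_eq_square)
        also have "\<dots> \<le> d * y j powr \<theta> + (1 / y (Suc j))\<^sup>2 * J'"
        proof -
          have "d * y j powr \<theta> / r\<^sup>2 \<le> d * y j powr \<theta> / 1"
            using d r by (intro divide_left_mono) auto
          then show ?thesis by simp
        qed
        finally show "ereal (R / r\<^sup>2) \<le> ereal (d * y j powr \<theta>) + ereal ((1 / y (Suc j))\<^sup>2) * J"
          by (simp add: J')
      qed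
      have middle: "exp_upper \<gamma> (\<lambda>n. \<Sum>j<m. ?q j n) (ereal (R / r\<^sup>2))"
        by (rule exp_upper_sum[OF \<gamma>, of "{..<m}" ?q]) (auto intro: cell)
      have ends: "exp_upper \<gamma> (\<lambda>n. prob {\<omega>\<in>space M. 1 / y 0 \<le> W n \<omega>} + prob {\<omega>\<in>space M. y m \<le> A n \<omega>})
        (ereal (R / r\<^sup>2))"
      proof (rule exp_upper_add[OF \<gamma>])
        have "ereal (R / r\<^sup>2) \<le> ereal ((1 / y 0)\<^sup>2) * J"
          using Rr a0 by (simp add: J' y_def power_divide)
        then show "exp_upper \<gamma> (\<lambda>n. prob {\<omega>\<in>space M. 1 / y 0 \<le> W n \<omega>}) (ereal (R / r\<^sup>2))"
          using y(1) by (intro exp_upper_antimono[OF W_upper]) auto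
        show "exp_upper \<gamma> (\<lambda>n. prob {\<omega>\<in>space M. y m \<le> A n \<omega>}) (ereal (R / r\<^sup>2))"
          using y(1) Rr m by (intro exp_upper_antimono[OF A_upper]) auto
      qed simp
      show ?thesis
      proof (rule exp_upper_add[OF \<gamma> ends middle])
        fix n
        let ?low = "{\<omega>\<in>space M. 1 / y 0 \<le> W n \<omega>}" and ?high = "{\<omega>\<in>space M. y m \<le> A n \<omega>}"
        let ?cell = "\<lambda>j. {\<omega>\<in>space M. y j \<le> A n \<omega> \<and> 1 / y (Suc j) \<le> W n \<omega>}"
        have "?p n \<le> prob ((?low \<union> ?high) \<union> (\<Union>j<m. ?cell j))"
        proof (intro finite_measure_mono subsetI)
          fix \<omega> assume "\<omega> \<in> {\<omega>\<in>space M. 1 \<le> A n \<omega> * W n \<omega>}"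
          then have \<omega>: "\<omega> \<in> space M" "1 \<le> A n \<omega> * W n \<omega>" by auto
          consider "A n \<omega> \<le> y 0" | "y m \<le> A n \<omega>" | "y 0 < A n \<omega>" "A n \<omega> \<le> y m" by linarith
          then show "\<omega> \<in> (?low \<union> ?high) \<union> (\<Union>j<m. ?cell j)"
          proof cases
            case 3
            then obtain j where "j < m" "y j \<le> A n \<omega>" "A n \<omega> \<le> y (Suc j)"
              using exists_grid_cell[of y "A n \<omega>" m] by auto
            then show ?thesis using W_large[OF \<omega>] \<omega> by blast
          qed (use W_large[OF \<omega>] \<omega> in auto)
        qed auto
        also have "\<dots> \<le> (prob ?low + prob ?high) + (\<Sum>j<m. prob (?cell j))"
          by (intro order_trans[OF measure_Un_le] add_mono measure_Un_le measure_UNION_le) auto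
        finally show "?p n \<le> (prob ?low + prob ?high) + (\<Sum>j<m. prob (?cell j))" .
      qed
    qed
    have "exp_upper \<gamma> ?p (ereal R)"
      unfolding exp_upper_def
    proof (intro allI impI)
      fix L assume "ereal L < ereal R"
      moreover have "((\<lambda>r. R / r\<^sup>2) \<longlongrightarrow> R / 1\<^sup>2) (at_right 1)"
        by (intro tendsto_intros) auto
      ultimately have "\<forall>\<^sub>F r in at_right 1. L < R / r\<^sup>2"
        by (auto dest: order_tendstoD)
      then obtain r where "r > 1" "L < R / r\<^sup>2"
        by (metis (no_types, lifting) eventually_at_right_less eventually_conj
            eventually_happens' trivial_limit_at_right_real)
      then show "\<forall>\<^sub>F n in sequentially. ?p n \<le> exp (- L * \<gamma> n)"
        using coarse by (auto simp: exp_upper_def)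
    qed
    moreover have "exp_lower \<gamma> ?p (ereal R)"
    proof -
      obtain a where a: "a > 0" "d * a powr \<theta> + J' / a\<^sup>2 = R"
        using minimum(2) by blast
      have "exp_lower \<gamma> (\<lambda>n. prob {\<omega>\<in>space M. a < A n \<omega>} * prob {\<omega>\<in>space M. 1 / a < W n \<omega>})
        (ereal (d * a powr \<theta> + J' / a\<^sup>2))"
        using A_lower[OF a(1)] W_lower[of "1 / a"] a(1)
        by (intro exp_lower_mult) (auto simp: J' power_divide)
      then show ?thesis
        unfolding a(2)
      proof (rule exp_lower_increase)
        fix n
        have "prob {\<omega>\<in>space M. a < A n \<omega> \<and> 1 / a < W n \<omega>} \<le> ?p n"
        proof (rule finite_measure_mono)
          show "{\<omega>\<in>space M. a < A n \<omega> \<and> 1 / a < W n \<omega>} \<subseteq> {\<omega>\<in>space M. 1 \<le> A n \<omega> * W n \<omega>}"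
          proof safe
            fix \<omega> assume "a < A n \<omega>" "1 / a < W n \<omega>"
            then have "a * (1 / a) \<le> A n \<omega> * W n \<omega>"
              using a(1) by (intro mult_mono) auto
            then show "1 \<le> A n \<omega> * W n \<omega>" using a(1) by simp
          qed
        qed auto
        then show "prob {\<omega>\<in>space M. a < A n \<omega>} * prob {\<omega>\<in>space M. 1 / a < W n \<omega>} \<le> ?p n"
          by (simp only: indep_gt)
      qed
    qed
    ultimately show ?thesis by (simp only: R_eq)
  qed
  then show "exp_upper \<gamma> ?p ?R" "exp_lower \<gamma> ?p ?R" by auto
qed

section \<open>Square integrable functions and centered normal variables\<close>

text \<open>The second identity is the value at \<open>1\<close> of the characteristic function of \<open>Y\<close>. It expresses the variance
  through the expectation of a bounded continuous function.\<close>
lemma centered_normal_moments: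
  assumes "prob_space M" "centered_normal M Y"
  shows "integrable M (\<lambda>\<omega>. (Y \<omega>)\<^sup>2)"
    and "(\<integral>\<omega>. cos (Y \<omega>) \<partial>M) = exp (- (\<integral>\<omega>. (Y \<omega>)\<^sup>2 \<partial>M) / 2)"
proof -
  interpret prob_space M by fact
  obtain \<sigma> where Y [measurable]: "Y \<in> borel_measurable M" and \<sigma>: "\<sigma> \<ge> 0"
    and D: "distr M borel Y = (if \<sigma> = 0 then return borel 0
      else density lborel (\<lambda>x. ennreal (normal_density 0 \<sigma> x)))"
    using assms(2) unfolding centered_normal_def by blast
  have "integrable M (\<lambda>\<omega>. (Y \<omega>)\<^sup>2) \<and>
    (\<integral>\<omega>. cos (Y \<omega>) \<partial>M) = exp (- (\<integral>\<omega>. (Y \<omega>)\<^sup>2 \<partial>M) / 2)"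
  proof (cases "\<sigma> = 0")
    case True
    have "integrable (distr M borel Y) (\<lambda>x. x\<^sup>2)"
      unfolding D using True by (auto intro!: integrableI_bounded simp: nn_integral_return)
    moreover have "(\<integral>x. cos x \<partial>distr M borel Y) = 1" "(\<integral>x. x\<^sup>2 \<partial>distr M borel Y) = 0"
      unfolding D using True by (auto simp: integral_return)
    ultimately show ?thesis
      by (simp add: integrable_distr_eq integral_distr)
  next
    case False
    then have \<sigma>: "\<sigma> > 0" using \<open>\<sigma> \<ge> 0\<close> by simp
    have dist: "distributed M lborel Y (normal_density 0 \<sigma>)"
      using D False by (auto simp: distributed_def cong: distr_cong)
    have sq: "integrable M (\<lambda>\<omega>. (Y \<omega>)\<^sup>2)"
      using integrable_normal_moment[OF \<sigma>, of 0 2]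
      by (subst distributed_integrable[OF dist, symmetric, of "\<lambda>x. x\<^sup>2"]) auto
    have var: "(\<integral>\<omega>. (Y \<omega>)\<^sup>2 \<partial>M) = \<sigma>\<^sup>2"
      using normal_distributed_variance[OF \<sigma> dist] normal_distributed_expectation[OF \<sigma> dist] by simp
    have "distributed M lborel (\<lambda>\<omega>. (Y \<omega> - 0) / \<sigma>) std_normal_density"
      using normal_standard_normal_convert[OF \<sigma>] dist by blast
    then have std: "distr M borel (\<lambda>\<omega>. Y \<omega> / \<sigma>) = std_normal_distribution"
      by (simp add: distributed_def cong: distr_cong)
    have int: "integrable (distr M borel (\<lambda>\<omega>. Y \<omega> / \<sigma>)) (\<lambda>x. iexp (\<sigma> * x))"
      by (simp add: integrable_distr_eq integrable_const_bound[of _ 1])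
    have "(\<integral>\<omega>. cos (Y \<omega>) \<partial>M) = (\<integral>x. cos (\<sigma> * x) \<partial>distr M borel (\<lambda>\<omega>. Y \<omega> / \<sigma>))"
      using \<sigma> by (simp add: integral_distr)
    also have "\<dots> = (\<integral>x. Re (iexp (\<sigma> * x)) \<partial>distr M borel (\<lambda>\<omega>. Y \<omega> / \<sigma>))"
      by (simp add: Re_exp)
    also have "\<dots> = Re (char (distr M borel (\<lambda>\<omega>. Y \<omega> / \<sigma>)) \<sigma>)"
      unfolding char_def using int by (subst integral_Re) auto
    also have "\<dots> = exp (- \<sigma>\<^sup>2 / 2)"
      unfolding std char_std_normal_distribution by simp
    finally show ?thesis
      using sq var by simp
  qed
  then show "integrable M (\<lambda>\<omega>. (Y \<omega>)\<^sup>2)"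
    "(\<integral>\<omega>. cos (Y \<omega>) \<partial>M) = exp (- (\<integral>\<omega>. (Y \<omega>)\<^sup>2 \<partial>M) / 2)" by auto
qed

lemma integrable_mult_of_squares:
  fixes Y Z :: "'a \<Rightarrow> real"
  assumes [measurable]: "Y \<in> borel_measurable M" "Z \<in> borel_measurable M"
    and sq: "integrable M (\<lambda>\<omega>. (Y \<omega>)\<^sup>2)" "integrable M (\<lambda>\<omega>. (Z \<omega>)\<^sup>2)"
  shows "integrable M (\<lambda>\<omega>. Y \<omega> * Z \<omega>)"
proof (rule Bochner_Integration.integrable_bound[OF Bochner_Integration.integrable_add[OF sq]])
  have "norm (y * z) \<le> norm (y\<^sup>2 + z\<^sup>2)" for y z :: real
  proof -
    have "2 * (\<bar>y\<bar> * \<bar>z\<bar>) \<le> y\<^sup>2 + z\<^sup>2"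
      using sum_squares_bound[of "\<bar>y\<bar>" "\<bar>z\<bar>"] by (simp add: mult.assoc)
    moreover have "0 \<le> \<bar>y\<bar> * \<bar>z\<bar>" by simp
    ultimately have "\<bar>y * z\<bar> \<le> y\<^sup>2 + z\<^sup>2" unfolding abs_mult by linarith
    then show ?thesis by (metis abs_ge_self order_trans real_norm_def)
  qed
  then show "AE \<omega> in M. norm (Y \<omega> * Z \<omega>) \<le> norm ((Y \<omega>)\<^sup>2 + (Z \<omega>)\<^sup>2)"
    by (intro AE_I2)
qed simp

text \<open>The quadratic polynomial \<open>s \<mapsto> \<integral> (Z + s Y)\<^sup>2\<close> is nonnegative.\<close>
lemma integral_Cauchy_Schwarz:
  fixes Y Z :: "'a \<Rightarrow> real"
  assumes [measurable]: "Y \<in> borel_measurable M" "Z \<in> borel_measurable M"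
    and sq: "integrable M (\<lambda>\<omega>. (Y \<omega>)\<^sup>2)" "integrable M (\<lambda>\<omega>. (Z \<omega>)\<^sup>2)"
  shows "(\<integral>\<omega>. Y \<omega> * Z \<omega> \<partial>M)\<^sup>2 \<le> (\<integral>\<omega>. (Y \<omega>)\<^sup>2 \<partial>M) * (\<integral>\<omega>. (Z \<omega>)\<^sup>2 \<partial>M)"
proof -
  let ?a = "\<integral>\<omega>. (Y \<omega>)\<^sup>2 \<partial>M" and ?b = "\<integral>\<omega>. Y \<omega> * Z \<omega> \<partial>M" and ?c = "\<integral>\<omega>. (Z \<omega>)\<^sup>2 \<partial>M"
  have quad: "0 \<le> ?a * s\<^sup>2 + 2 * ?b * s + ?c" for s
  proof -
    have "0 \<le> (\<integral>\<omega>. (Z \<omega> + s * Y \<omega>)\<^sup>2 \<partial>M)" by simp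
    also have "\<dots> = (\<integral>\<omega>. s\<^sup>2 * (Y \<omega>)\<^sup>2 + 2 * s * (Y \<omega> * Z \<omega>) + (Z \<omega>)\<^sup>2 \<partial>M)"
      by (rule Bochner_Integration.integral_cong) (auto simp: power2_eq_square algebra_simps)
    also have "\<dots> = ?a * s\<^sup>2 + 2 * ?b * s + ?c"
      using sq integrable_mult_of_squares[OF assms] by simp
    finally show ?thesis .
  qed
  have a: "0 \<le> ?a" by simp
  show ?thesis
  proof (cases "?a = 0")
    case True
    have "?b = 0"
    proof (rule ccontr)
      assume "?b \<noteq> 0"
      with quad[of "- (?c + 1) / (2 * ?b)"] True show False by simp
    qed
    then show ?thesis using True by simp
  next
    case False
    with a have a: "?a > 0" by (metis less_le)
    have "0 \<le> ?a * (?a * (- ?b / ?a)\<^sup>2 + 2 * ?b * (- ?b / ?a) + ?c)"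
      by (intro mult_nonneg_nonneg quad) simp
    also have "\<dots> = ?a * ?c - ?b\<^sup>2"
      using a by (simp add: field_simps power2_eq_square)
    finally show ?thesis by simp
  qed
qed

text \<open>For centered normal variables, pointwise convergence carries over to the variances:
  dominated convergence applies to the cosines, and the variance is \<open>-2 ln\<close> of their expectation.\<close>
lemma centered_normal_variance_tendsto:
  assumes "prob_space M" and normal: "\<And>n. centered_normal M (Y n)" "centered_normal M Y'"
    and lim: "\<And>\<omega>. \<omega> \<in> space M \<Longrightarrow> (\<lambda>n. Y n \<omega>) \<longlonglongrightarrow> Y' \<omega>"
  shows "(\<lambda>n. \<integral>\<omega>. (Y n \<omega>)\<^sup>2 \<partial>M) \<longlonglongrightarrow> (\<integral>\<omega>. (Y' \<omega>)\<^sup>2 \<partial>M)"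
proof -
  interpret prob_space M by fact
  have [measurable]: "Y n \<in> borel_measurable M" "Y' \<in> borel_measurable M" for n
    using normal by (auto simp: centered_normal_def)
  have variance: "(\<integral>\<omega>. (Z \<omega>)\<^sup>2 \<partial>M) = - 2 * ln (\<integral>\<omega>. cos (Z \<omega>) \<partial>M)" if "centered_normal M Z" for Z
    by (simp add: centered_normal_moments(2)[OF assms(1) that])
  have "(\<lambda>n. \<integral>\<omega>. cos (Y n \<omega>) \<partial>M) \<longlonglongrightarrow> (\<integral>\<omega>. cos (Y' \<omega>) \<partial>M)"
    by (rule integral_dominated_convergence[where w = "\<lambda>_. 1"])
      (auto intro!: AE_I2 tendsto_cos lim)
  then show ?thesis
    unfolding variance[OF normal(1)] variance[OF normal(2)]
    by (intro tendsto_intros) (auto simp: centered_normal_moments(2)[OF assms(1) normal(2)])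
qed

section \<open>Continuous Gaussian processes\<close>

locale continuous_gaussian_process = prob_space N
  for N :: "'v measure" and T :: real and U :: "real \<Rightarrow> 'v \<Rightarrow> real" +
  assumes continuous_paths: "continuous_process N T U"
    and gaussian: "centered_gaussian_process N T U"
begin

abbreviation cov :: "real \<Rightarrow> real \<Rightarrow> real" where
  "cov s t \<equiv> \<integral>\<omega>. U s \<omega> * U t \<omega> \<partial>N"

lemma measurable_U: "t \<in> {0..T} \<Longrightarrow> U t \<in> borel_measurable N"
  using continuous_paths by (simp add: continuous_process_def)

lemma continuous_path: "\<omega> \<in> space N \<Longrightarrow> continuous_on {0..T} (\<lambda>t. U t \<omega>)"
  using continuous_paths by (simp add: continuous_process_def)

lemma centered_normal_U:
  assumes "t \<in> {0..T}"
  shows "centered_normal N (U t)"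
proof -
  have "centered_normal N (\<lambda>\<omega>. \<Sum>s\<in>{t}. 1 \<bullet> U s \<omega>)"
    using gaussian assms unfolding centered_gaussian_process_def
    by (elim conjE allE[of _ "{t}"] allE[of _ "\<lambda>_. 1"]) auto
  then show ?thesis by simp
qed

lemma centered_normal_increment:
  assumes "s \<in> {0..T}" "t \<in> {0..T}"
  shows "centered_normal N (\<lambda>\<omega>. U s \<omega> - U t \<omega>)"
proof -
  define c where "c = (\<lambda>r. (if r = s then 1 else 0) - (if r = t then 1 else 0 :: real))"
  have "centered_normal N (\<lambda>\<omega>. \<Sum>r\<in>{s, t}. c r \<bullet> U r \<omega>)"
    using gaussian assms unfolding centered_gaussian_process_def
    by (elim conjE allE[of _ "{s, t}"] allE[of _ c]) auto
  moreover have "(\<Sum>r\<in>{s, t}. c r \<bullet> U r \<omega>) = U s \<omega> - U t \<omega>" for \<omega>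
    by (cases "s = t") (auto simp: c_def)
  ultimately show ?thesis by simp
qed

lemma square_integrable_U: "t \<in> {0..T} \<Longrightarrow> integrable N (\<lambda>\<omega>. (U t \<omega>)\<^sup>2)"
  by (intro centered_normal_moments(1) centered_normal_U) unfold_locales

lemma path_tendsto:
  assumes "\<omega> \<in> space N" "\<And>n. u n \<in> {0..T}" "a \<in> {0..T}" "u \<longlonglongrightarrow> a"
  shows "(\<lambda>n. U (u n) \<omega>) \<longlonglongrightarrow> U a \<omega>"
  using continuous_on_tendsto_compose[OF continuous_path[OF assms(1)] assms(4,3)] assms(2)
  by simp

lemma variance_bounded:
  obtains K where "\<And>t. t \<in> {0..T} \<Longrightarrow> (\<integral>\<omega>. (U t \<omega>)\<^sup>2 \<partial>N) \<le> K"
proof -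
  have "continuous_on {0..T} (\<lambda>t. \<integral>\<omega>. (U t \<omega>)\<^sup>2 \<partial>N)"
    by (rule continuous_on_sequentiallyI,
        rule centered_normal_variance_tendsto[OF prob_space_axioms])
      (auto intro: centered_normal_U path_tendsto)
  then have "bounded ((\<lambda>t. \<integral>\<omega>. (U t \<omega>)\<^sup>2 \<partial>N) ` {0..T})"
    by (intro compact_imp_bounded compact_continuous_image) auto
  then obtain K where "\<forall>v\<in>(\<lambda>t. \<integral>\<omega>. (U t \<omega>)\<^sup>2 \<partial>N) ` {0..T}. norm v \<le> K"
    unfolding bounded_iff by blast
  then show ?thesis by (intro that[of K]) force
qed

text \<open>The increments \<open>U\<^sub>s - U\<^sub>t\<close> are centered normal and tend to \<open>0\<close> as \<open>s\<close> tends to \<open>t\<close>, hence so do their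
  variances; Cauchy-Schwarz transfers this to the covariance with \<open>Y\<close>. It makes the functions
  \<open>k(\<cdot>,t)\<close> elements of the path space.\<close>
lemma continuous_on_covariance_with:
  assumes [measurable]: "Y \<in> borel_measurable N" and Y: "integrable N (\<lambda>\<omega>. (Y \<omega>)\<^sup>2)"
  shows "continuous_on {0..T} (\<lambda>t. \<integral>\<omega>. U t \<omega> * Y \<omega> \<partial>N)"
proof (rule continuous_on_sequentiallyI)
  fix u a assume u: "\<forall>n. u n \<in> {0..T}" and a: "a \<in> {0..T}" and lim: "u \<longlonglongrightarrow> a"
  note [measurable] = measurable_U
  have inc: "centered_normal N (\<lambda>\<omega>. U (u n) \<omega> - U a \<omega>)" for n
    using u a by (intro centered_normal_increment) auto
  have incM [measurable]: "(\<lambda>\<omega>. U (u n) \<omega> - U a \<omega>) \<in> borel_measurable N" for n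
    using inc by (auto simp: centered_normal_def)
  have inc_sq: "integrable N (\<lambda>\<omega>. (U (u n) \<omega> - U a \<omega>)\<^sup>2)" for n
    by (rule centered_normal_moments(1)[OF prob_space_axioms inc])
  have zero: "centered_normal N (\<lambda>\<omega>. U a \<omega> - U a \<omega>)"
    using a by (intro centered_normal_increment)
  have "(\<lambda>n. \<integral>\<omega>. (U (u n) \<omega> - U a \<omega>)\<^sup>2 \<partial>N) \<longlonglongrightarrow> (\<integral>\<omega>. (U a \<omega> - U a \<omega>)\<^sup>2 \<partial>N)"
    using u a lim by (intro centered_normal_variance_tendsto[OF prob_space_axioms inc zero]
        tendsto_diff path_tendsto) auto
  then have "(\<lambda>n. sqrt ((\<integral>\<omega>. (U (u n) \<omega> - U a \<omega>)\<^sup>2 \<partial>N) * (\<integral>\<omega>. (Y \<omega>)\<^sup>2 \<partial>N))) \<longlonglongrightarrow> sqrt (0 * (\<integral>\<omega>. (Y \<omega>)\<^sup>2 \<partial>N))"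
    by (intro tendsto_intros) simp
  then have bound_lim: "(\<lambda>n. sqrt ((\<integral>\<omega>. (U (u n) \<omega> - U a \<omega>)\<^sup>2 \<partial>N) * (\<integral>\<omega>. (Y \<omega>)\<^sup>2 \<partial>N))) \<longlonglongrightarrow> 0"
    by simp
  have "\<bar>(\<integral>\<omega>. U (u n) \<omega> * Y \<omega> \<partial>N) - (\<integral>\<omega>. U a \<omega> * Y \<omega> \<partial>N)\<bar>
      \<le> sqrt ((\<integral>\<omega>. (U (u n) \<omega> - U a \<omega>)\<^sup>2 \<partial>N) * (\<integral>\<omega>. (Y \<omega>)\<^sup>2 \<partial>N))" for n
  proof -
    have "integrable N (\<lambda>\<omega>. U t \<omega> * Y \<omega>)" if "t \<in> {0..T}" for t
      using that Y by (intro integrable_mult_of_squares square_integrable_U measurable_U) auto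
    then have "(\<integral>\<omega>. U (u n) \<omega> * Y \<omega> \<partial>N) - (\<integral>\<omega>. U a \<omega> * Y \<omega> \<partial>N) = (\<integral>\<omega>. (U (u n) \<omega> - U a \<omega>) * Y \<omega> \<partial>N)"
      using u a by (simp add: left_diff_distrib)
    then show ?thesis
      using integral_Cauchy_Schwarz[OF incM assms(1) inc_sq Y]
      by (simp add: real_le_rsqrt)
  qed
  then have "\<forall>\<^sub>F n in sequentially. norm ((\<integral>\<omega>. U (u n) \<omega> * Y \<omega> \<partial>N) - (\<integral>\<omega>. U a \<omega> * Y \<omega> \<partial>N))
      \<le> sqrt ((\<integral>\<omega>. (U (u n) \<omega> - U a \<omega>)\<^sup>2 \<partial>N) * (\<integral>\<omega>. (Y \<omega>)\<^sup>2 \<partial>N))"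
    by simp
  from Lim_null_comparison[OF this bound_lim]
  show "(\<lambda>n. \<integral>\<omega>. U (u n) \<omega> * Y \<omega> \<partial>N) \<longlonglongrightarrow> (\<integral>\<omega>. U a \<omega> * Y \<omega> \<partial>N)"
    by (subst LIM_zero_iff[symmetric])
qed

text \<open>By path continuity \<open>U\<^sub>t\<close> is the limit of \<open>U\<close> at the grid point \<open>\<lfloor>n t\<rfloor> / n\<close>, which takes countably
  many values. Joint measurability is what Fubini requires below.\<close>
lemma jointly_measurable:
  "(\<lambda>(t, \<omega>). U t \<omega>) \<in> borel_measurable (restrict_space borel {0..T} \<Otimes>\<^sub>M N)"
proof (rule borel_measurable_LIMSEQ_real)
  let ?R = "restrict_space borel {0..T} :: real measure"
  let ?grid = "\<lambda>n t. real_of_int \<lfloor>real (Suc n) * t\<rfloor> / real (Suc n)"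
  let ?f = "\<lambda>n (t, \<omega>). if ?grid n t \<in> {0..T} then U (?grid n t) \<omega> else 0"
  show "?f n \<in> borel_measurable (?R \<Otimes>\<^sub>M N)" for n
  proof -
    \<comment> \<open>\<open>?f n\<close>, with the numerator of the grid point as a parameter\<close>
    let ?g = "\<lambda>(i::int) x. if real_of_int i / real (Suc n) \<in> {0..T} then U (real_of_int i / real (Suc n)) (snd x) else 0"
    have "(\<lambda>x. ?g i x) \<in> borel_measurable (?R \<Otimes>\<^sub>M N)" for i
    proof (cases "real_of_int i / real (Suc n) \<in> {0..T}")
      case True
      have "(\<lambda>x. U (real_of_int i / real (Suc n)) (snd x)) \<in> borel_measurable (?R \<Otimes>\<^sub>M N)"
        by (rule measurable_compose[OF measurable_snd measurable_U[OF True]])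
      then show ?thesis using True by simp
    next
      case False
      then show ?thesis by (simp only: if_False) simp
    qed
    moreover have "(\<lambda>x. \<lfloor>real (Suc n) * fst x\<rfloor>) \<in> measurable (?R \<Otimes>\<^sub>M N) (count_space UNIV)"
      by (intro measurable_compose[OF _ measurable_real_floor] borel_measurable_times
          borel_measurable_const measurable_compose[OF measurable_fst] measurable_restrict_space1) simp
    ultimately have "(\<lambda>x. ?g \<lfloor>real (Suc n) * fst x\<rfloor> x) \<in> borel_measurable (?R \<Otimes>\<^sub>M N)"
      by (rule measurable_compose_countable)
    then show ?thesis
      by (rule measurable_cong[THEN iffD1, rotated]) (auto simp: split_beta)
  qed
  show "(\<lambda>n. ?f n x) \<longlonglongrightarrow> (case x of (t, \<omega>) \<Rightarrow> U t \<omega>)" if x: "x \<in> space (?R \<Otimes>\<^sub>M N)" for x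
  proof -
    obtain t \<omega> where x_eq: "x = (t, \<omega>)" and t: "t \<in> {0..T}" and \<omega>: "\<omega> \<in> space N"
      using x by (auto simp: space_pair_measure space_restrict_space)
    have upper: "?grid n t \<le> t" for n
      by (simp add: divide_le_eq mult.commute)
    have lower: "t - 1 / real (Suc n) \<le> ?grid n t" for n
    proof -
      have "real (Suc n) * t - 1 \<le> real_of_int \<lfloor>real (Suc n) * t\<rfloor>" by linarith
      then have "(real (Suc n) * t - 1) / real (Suc n) \<le> ?grid n t"
        by (intro divide_right_mono) auto
      then show ?thesis by (simp add: diff_divide_distrib del: of_nat_Suc)
    qed
    have mem: "?grid n t \<in> {0..T}" for n
      using t upper[of n] by (auto simp del: of_nat_Suc intro: order_trans)
    have "(\<lambda>n. ?grid n t) \<longlonglongrightarrow> t"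
    proof (rule tendsto_sandwich[OF _ _ _ tendsto_const])
      have "(\<lambda>n. t - 1 / real (Suc n)) \<longlonglongrightarrow> t - 0"
        by (intro tendsto_diff tendsto_const LIMSEQ_Suc[OF lim_1_over_n])
      then show "(\<lambda>n. t - 1 / real (Suc n)) \<longlonglongrightarrow> t" by simp
    qed (use lower upper in auto)
    from path_tendsto[OF \<omega> mem t this] show ?thesis
      using mem by (simp add: x_eq)
  qed
qed

text \<open>Fubini exchanges the integral over \<open>t\<close> with the expectation. It applies because
  \<open>E \<bar>U\<^sub>t D\<bar> \<le> sqrt (E U\<^sub>t\<^sup>2 \<cdot> E D\<^sup>2)\<close>, which is bounded in \<open>t\<close>.\<close>
lemma orthogonal_to_measure_integral:
  assumes \<alpha>: "finite_borel_measure T \<alpha>"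
    and [measurable]: "D \<in> borel_measurable N" and D: "integrable N (\<lambda>\<omega>. (D \<omega>)\<^sup>2)"
    and orth: "\<And>t. t \<in> {0..T} \<Longrightarrow> (\<integral>\<omega>. U t \<omega> * D \<omega> \<partial>N) = 0"
  shows "(\<lambda>\<omega>. \<integral>t. U t \<omega> \<partial>\<alpha>) \<in> borel_measurable N"
    and "integrable N (\<lambda>\<omega>. (\<integral>t. U t \<omega> \<partial>\<alpha>) * D \<omega>)"
    and "(\<integral>\<omega>. (\<integral>t. U t \<omega> \<partial>\<alpha>) * D \<omega> \<partial>N) = 0"
proof -
  have N: "sigma_finite_measure N" by unfold_locales
  interpret \<alpha>: finite_measure \<alpha> using \<alpha> by (simp add: finite_borel_measure_def)
  interpret pair_sigma_finite \<alpha> N by unfold_locales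
  have sets: "sets \<alpha> = sets (restrict_space borel {0..T})"
    using \<alpha> by (simp add: finite_borel_measure_def)
  have space: "space \<alpha> = {0..T}"
    using sets_eq_imp_space_eq[OF sets] by (simp add: space_restrict_space)
  have joint [measurable]: "(\<lambda>(t, \<omega>). U t \<omega>) \<in> borel_measurable (\<alpha> \<Otimes>\<^sub>M N)"
    using jointly_measurable
    by (subst measurable_cong_sets[OF sets_pair_measure_cong[OF sets refl] refl])
  have joint' [measurable]: "(\<lambda>(\<omega>, t). U t \<omega>) \<in> borel_measurable (N \<Otimes>\<^sub>M \<alpha>)"
    using measurable_compose[OF measurable_pair_swap' joint] by (simp add: split_beta)
  show "(\<lambda>\<omega>. \<integral>t. U t \<omega> \<partial>\<alpha>) \<in> borel_measurable N"
    using joint' by (rule \<alpha>.borel_measurable_lebesgue_integral)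
  obtain K where K: "\<And>t. t \<in> {0..T} \<Longrightarrow> (\<integral>\<omega>. (U t \<omega>)\<^sup>2 \<partial>N) \<le> K"
    using variance_bounded by blast
  have prod: "integrable N (\<lambda>\<omega>. U t \<omega> * D \<omega>)" if "t \<in> {0..T}" for t
    using that D by (intro integrable_mult_of_squares square_integrable_U measurable_U) auto
  have int: "integrable (\<alpha> \<Otimes>\<^sub>M N) (\<lambda>(t, \<omega>). U t \<omega> * D \<omega>)"
  proof (rule Fubini_integrable)
    show meas: "(\<lambda>(t, \<omega>). U t \<omega> * D \<omega>) \<in> borel_measurable (\<alpha> \<Otimes>\<^sub>M N)"
      using joint by measurable
    let ?f = "\<lambda>t. \<integral>\<omega>. norm (case (t, \<omega>) of (t, \<omega>) \<Rightarrow> U t \<omega> * D \<omega>) \<partial>N"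
    show "integrable \<alpha> ?f"
    proof (rule \<alpha>.integrable_const_bound[of _ "sqrt (K * (\<integral>\<omega>. (D \<omega>)\<^sup>2 \<partial>N))"])
      show "?f \<in> borel_measurable \<alpha>"
      proof -
        have "(\<lambda>(t, \<omega>). norm (U t \<omega> * D \<omega>)) \<in> borel_measurable (\<alpha> \<Otimes>\<^sub>M N)"
          using joint by measurable
        then show ?thesis
          using sigma_finite_measure.borel_measurable_lebesgue_integral[OF N] by simp
      qed
      show "AE t in \<alpha>. norm (?f t) \<le> sqrt (K * (\<integral>\<omega>. (D \<omega>)\<^sup>2 \<partial>N))"
      proof (rule AE_I2)
        fix t assume "t \<in> space \<alpha>"
        then have t: "t \<in> {0..T}" by (simp add: space)
        note [measurable] = measurable_U[OF t]
        have "(\<integral>\<omega>. \<bar>U t \<omega>\<bar> * \<bar>D \<omega>\<bar> \<partial>N)\<^sup>2 \<le> (\<integral>\<omega>. \<bar>U t \<omega>\<bar>\<^sup>2 \<partial>N) * (\<integral>\<omega>. \<bar>D \<omega>\<bar>\<^sup>2 \<partial>N)"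
          using square_integrable_U[OF t] D by (intro integral_Cauchy_Schwarz) auto
        also have "\<dots> \<le> K * (\<integral>\<omega>. (D \<omega>)\<^sup>2 \<partial>N)"
          using K[OF t] by (simp add: mult_right_mono)
        finally show "norm (?f t) \<le> sqrt (K * (\<integral>\<omega>. (D \<omega>)\<^sup>2 \<partial>N))"
          by (simp add: real_le_rsqrt abs_mult)
      qed
    qed
    show "AE t in \<alpha>. integrable N (\<lambda>\<omega>. case (t, \<omega>) of (t, \<omega>) \<Rightarrow> U t \<omega> * D \<omega>)"
      using prod space by (intro AE_I2) auto
  qed
  have "integrable N (\<lambda>\<omega>. \<integral>t. U t \<omega> * D \<omega> \<partial>\<alpha>)"
    using integrable_snd[OF int] by simp
  then show "integrable N (\<lambda>\<omega>. (\<integral>t. U t \<omega> \<partial>\<alpha>) * D \<omega>)"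
    by simp
  have "(\<integral>\<omega>. (\<integral>t. U t \<omega> \<partial>\<alpha>) * D \<omega> \<partial>N) = (\<integral>\<omega>. (\<integral>t. U t \<omega> * D \<omega> \<partial>\<alpha>) \<partial>N)"
    by simp
  also have "\<dots> = (\<integral>t. (\<integral>\<omega>. U t \<omega> * D \<omega> \<partial>N) \<partial>\<alpha>)"
    using Fubini_integral[OF int] by simp
  also have "\<dots> = (\<integral>t. 0 \<partial>\<alpha>)"
    using orth space by (intro Bochner_Integration.integral_cong) auto
  finally show "(\<integral>\<omega>. (\<integral>t. U t \<omega> \<partial>\<alpha>) * D \<omega> \<partial>N) = 0" by simp
qed

section \<open>The cost of reaching a level at a given time\<close>

lemma gaussian_space_L2:
  assumes "Y \<in> gaussian_space N T U"
  shows "Y \<in> borel_measurable N" "integrable N (\<lambda>\<omega>. (Y \<omega>)\<^sup>2)"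
  using assms by (auto simp: gaussian_space_def L2_closure_def)

text \<open>Orthogonality passes from the integrals of the process to their \<open>L\<^sup>2\<close>-closure, by Cauchy-Schwarz.\<close>
lemma orthogonal_to_gaussian_space:
  assumes Y: "Y \<in> gaussian_space N T U"
    and [measurable]: "D \<in> borel_measurable N" and D: "integrable N (\<lambda>\<omega>. (D \<omega>)\<^sup>2)"
    and orth: "\<And>t. t \<in> {0..T} \<Longrightarrow> (\<integral>\<omega>. U t \<omega> * D \<omega> \<partial>N) = 0"
  shows "(\<integral>\<omega>. Y \<omega> * D \<omega> \<partial>N) = 0"
proof -
  note [measurable] = gaussian_space_L2(1)[OF Y]
  note Y2 = gaussian_space_L2(2)[OF Y]
  let ?d = "\<integral>\<omega>. (D \<omega>)\<^sup>2 \<partial>N"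
  have small: "(\<integral>\<omega>. Y \<omega> * D \<omega> \<partial>N)\<^sup>2 \<le> e * ?d" if e: "e > 0" for e
  proof -
    obtain V where V: "V \<in> signed_integrals T U"
      and close: "(\<integral>\<^sup>+\<omega>. ennreal ((Y \<omega> - V \<omega>)\<^sup>2) \<partial>N) < ennreal e"
      using Y e unfolding gaussian_space_def L2_closure_def by blast
    obtain \<alpha> \<beta> where \<alpha>: "finite_borel_measure T \<alpha>" and \<beta>: "finite_borel_measure T \<beta>"
      and V_eq: "V = (\<lambda>\<omega>. (\<integral>t. U t \<omega> \<partial>\<alpha>) - (\<integral>t. U t \<omega> \<partial>\<beta>))"
      using V unfolding signed_integrals_def by blast
    note a = orthogonal_to_measure_integral[OF \<alpha> assms(2) D orth]
    note b = orthogonal_to_measure_integral[OF \<beta> assms(2) D orth]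
    have [measurable]: "V \<in> borel_measurable N"
      unfolding V_eq using a(1) b(1) by measurable
    have VD: "integrable N (\<lambda>\<omega>. V \<omega> * D \<omega>)" "(\<integral>\<omega>. V \<omega> * D \<omega> \<partial>N) = 0"
      using a(2,3) b(2,3) by (simp_all add: V_eq left_diff_distrib)
    have sq: "integrable N (\<lambda>\<omega>. (Y \<omega> - V \<omega>)\<^sup>2)"
      using close by (intro integrableI_bounded) (auto intro: less_trans)
    have "ennreal (\<integral>\<omega>. (Y \<omega> - V \<omega>)\<^sup>2 \<partial>N) < ennreal e"
      using close by (subst nn_integral_eq_integral[OF sq, symmetric]) auto
    then have sq_less: "(\<integral>\<omega>. (Y \<omega> - V \<omega>)\<^sup>2 \<partial>N) < e"
      by (simp add: ennreal_less_iff)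
    have "(\<integral>\<omega>. Y \<omega> * D \<omega> \<partial>N) = (\<integral>\<omega>. (Y \<omega> - V \<omega>) * D \<omega> \<partial>N)"
      using VD integrable_mult_of_squares[OF _ _ Y2 D] by (simp add: left_diff_distrib)
    then have "(\<integral>\<omega>. Y \<omega> * D \<omega> \<partial>N)\<^sup>2 \<le> (\<integral>\<omega>. (Y \<omega> - V \<omega>)\<^sup>2 \<partial>N) * ?d"
      using integral_Cauchy_Schwarz[OF _ _ sq D] by simp
    also have "\<dots> \<le> e * ?d"
      using sq_less by (intro mult_right_mono) auto
    finally show ?thesis .
  qed
  have "(\<integral>\<omega>. Y \<omega> * D \<omega> \<partial>N)\<^sup>2 \<le> 0"
  proof (rule tendsto_le[OF trivial_limit_at_right_real _ tendsto_const])
    show "((\<lambda>e. e * ?d) \<longlongrightarrow> 0) (at_right 0)"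
      by (rule tendsto_eq_intros refl)+ simp
    show "\<forall>\<^sub>F e in at_right 0. (\<integral>\<omega>. Y \<omega> * D \<omega> \<partial>N)\<^sup>2 \<le> e * ?d"
      using small eventually_at_right_less[of "0::real"] by (rule eventually_mono[rotated]) auto
  qed
  then show ?thesis by simp
qed

text \<open>The difference \<open>Z - Y\<close> is orthogonal to every \<open>U\<^sub>t\<close>, hence to \<open>Y\<close>, so \<open>E Y\<^sup>2 = E Y Z\<close>. With this the
  norm, defined through an unspecified preimage, can be bounded by means of a known one.\<close>
lemma energy_le_of_same_representer:
  assumes Y: "Y \<in> gaussian_space N T U"
    and [measurable]: "Z \<in> borel_measurable N" and Z: "integrable N (\<lambda>\<omega>. (Z \<omega>)\<^sup>2)"
    and same: "rkhs_map N T U Y = rkhs_map N T U Z"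
  shows "(\<integral>\<omega>. (Y \<omega>)\<^sup>2 \<partial>N) \<le> (\<integral>\<omega>. (Z \<omega>)\<^sup>2 \<partial>N)"
proof -
  note [measurable] = gaussian_space_L2(1)[OF Y]
  note Y2 = gaussian_space_L2(2)[OF Y]
  have YZ: "integrable N (\<lambda>\<omega>. Y \<omega> * Z \<omega>)"
    using Y2 Z by (intro integrable_mult_of_squares) auto
  have "integrable N (\<lambda>\<omega>. (Z \<omega>)\<^sup>2 + (Y \<omega>)\<^sup>2 - 2 * (Y \<omega> * Z \<omega>))"
    using Y2 Z YZ by auto
  then have D: "integrable N (\<lambda>\<omega>. (Z \<omega> - Y \<omega>)\<^sup>2)"
    by (simp add: power2_diff mult_ac)
  have "(\<integral>\<omega>. U t \<omega> * (Z \<omega> - Y \<omega>) \<partial>N) = 0" if t: "t \<in> {0..T}" for t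
  proof -
    note [measurable] = measurable_U[OF t]
    have "(\<integral>\<omega>. U t \<omega> * Y \<omega> \<partial>N) = (\<integral>\<omega>. U t \<omega> * Z \<omega> \<partial>N)"
      using fun_cong[OF same, of t] t by (simp add: rkhs_map_def)
    moreover have "integrable N (\<lambda>\<omega>. U t \<omega> * Y \<omega>)" "integrable N (\<lambda>\<omega>. U t \<omega> * Z \<omega>)"
      using Y2 Z square_integrable_U[OF t] by (auto intro!: integrable_mult_of_squares)
    ultimately show ?thesis by (simp add: right_diff_distrib)
  qed
  then have "(\<integral>\<omega>. Y \<omega> * (Z \<omega> - Y \<omega>) \<partial>N) = 0"
    using D by (intro orthogonal_to_gaussian_space[OF Y]) auto
  moreover have "Y \<omega> * (Z \<omega> - Y \<omega>) = Y \<omega> * Z \<omega> - (Y \<omega>)\<^sup>2" for \<omega>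
    by (simp add: algebra_simps power2_eq_square)
  ultimately have YZ_eq: "(\<integral>\<omega>. Y \<omega> * Z \<omega> \<partial>N) = (\<integral>\<omega>. (Y \<omega>)\<^sup>2 \<partial>N)"
    using Y2 YZ by simp
  have "0 \<le> (\<integral>\<omega>. (Z \<omega> - Y \<omega>)\<^sup>2 \<partial>N)" by simp
  also have "\<dots> = (\<integral>\<omega>. (Z \<omega>)\<^sup>2 + (Y \<omega>)\<^sup>2 - 2 * (Y \<omega> * Z \<omega>) \<partial>N)"
    by (simp add: power2_diff mult_ac)
  also have "\<dots> = (\<integral>\<omega>. (Z \<omega>)\<^sup>2 \<partial>N) + (\<integral>\<omega>. (Y \<omega>)\<^sup>2 \<partial>N) - 2 * (\<integral>\<omega>. Y \<omega> * Z \<omega> \<partial>N)"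
    using Y2 Z YZ by simp
  finally show ?thesis using YZ_eq by simp
qed

text \<open>If \<open>h = E[U Y]\<close> then \<open>h(t)\<^sup>2 \<le> k(t,t) \<cdot> E Y\<^sup>2\<close>. In the degenerate case \<open>k(t,t) = 0\<close> the left-hand side is
  infinite, and indeed no element of the Hilbert space is positive at \<open>t\<close>.\<close>
lemma rkhs_rate_lower_bound:
  assumes t: "t \<in> {0..T}" and a: "0 < a" "a \<le> h t"
  shows "ereal (1 / 2) * (ereal (a\<^sup>2) / ereal (cov t t)) \<le> rkhs_rate N T U h"
proof (cases "h \<in> rkhs N T U")
  case True
  define Y where "Y = inv_into (gaussian_space N T U) (rkhs_map N T U) h"
  have Y: "Y \<in> gaussian_space N T U" and h: "rkhs_map N T U Y = h"
    using True by (auto simp: Y_def rkhs_def inv_into_into f_inv_into_f)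
  have ht: "h t = (\<integral>\<omega>. U t \<omega> * Y \<omega> \<partial>N)"
    using t by (simp flip: h add: rkhs_map_def)
  have rate: "rkhs_rate N T U h = ereal (1 / 2 * (\<integral>\<omega>. (Y \<omega>)\<^sup>2 \<partial>N))"
    using True by (simp add: rkhs_rate_def rkhs_norm_def rkhs_inner_def power2_eq_square flip: Y_def)
  have "a\<^sup>2 \<le> (h t)\<^sup>2"
    using a by (intro power_mono) auto
  also have "\<dots> \<le> cov t t * (\<integral>\<omega>. (Y \<omega>)\<^sup>2 \<partial>N)"
    using integral_Cauchy_Schwarz[OF measurable_U[OF t] gaussian_space_L2(1)[OF Y]
        square_integrable_U[OF t] gaussian_space_L2(2)[OF Y]]
    by (simp add: ht power2_eq_square)
  finally have bound: "a\<^sup>2 \<le> cov t t * (\<integral>\<omega>. (Y \<omega>)\<^sup>2 \<partial>N)" .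
  have "cov t t \<noteq> 0" using bound a by (auto simp: not_le)
  moreover have "0 \<le> cov t t" by simp
  ultimately have "cov t t > 0" by (metis less_le)
  then show ?thesis
    using bound by (simp add: rate pos_divide_le_eq mult.commute)
qed (simp add: rkhs_rate_def)

text \<open>\<open>c U\<^sub>t\<close> is the integral of the process against the point mass \<open>c\<close> at \<open>t\<close>.\<close>
lemma scaled_evaluation_in_gaussian_space:
  assumes t: "t \<in> {0..T}" and c: "0 \<le> c"
  shows "(\<lambda>\<omega>. c * U t \<omega>) \<in> gaussian_space N T U"
proof -
  note [measurable] = measurable_U[OF t]
  let ?R = "restrict_space borel {0..T} :: real measure"
  let ?dirac = "\<lambda>c. density (return ?R t) (\<lambda>_. ennreal c)"
  have "t \<in> space ?R" using t by (simp add: space_restrict_space)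
  note t_R = this
  have finite: "finite_borel_measure T (?dirac c)" for c
  proof -
    have "emeasure (?dirac c) (space (?dirac c)) = (\<integral>\<^sup>+s. ennreal c * indicator (space ?R) s \<partial>return ?R t)"
      using sets.top[of ?R] by (subst emeasure_density) auto
    also have "\<dots> = ennreal c"
      using t_R sets.top[of ?R] by (subst nn_integral_return) (auto intro!: borel_measurable_indicator)
    finally show ?thesis
      unfolding finite_borel_measure_def by (auto intro!: finite_measureI)
  qed
  have integral: "(\<integral>s. U s \<omega> \<partial>?dirac c) = c * U t \<omega>" if "\<omega> \<in> space N" "0 \<le> c" for \<omega> c
  proof -
    have "(\<lambda>s. U s \<omega>) \<in> borel_measurable ?R"
      by (rule borel_measurable_continuous_on_restrict[OF continuous_path[OF that(1)]])
    then show ?thesis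
      using that(2) t_R by (simp add: integral_density integral_return)
  qed
  let ?V = "\<lambda>\<omega>. (\<integral>s. U s \<omega> \<partial>?dirac c) - (\<integral>s. U s \<omega> \<partial>?dirac 0)"
  have V: "?V \<in> signed_integrals T U"
    unfolding signed_integrals_def using finite[of c] finite[of 0] by blast
  have "?V \<omega> = c * U t \<omega>" if "\<omega> \<in> space N" for \<omega>
    using integral[OF that c] integral[OF that order_refl] by simp
  then have "(\<integral>\<^sup>+\<omega>. ennreal ((c * U t \<omega> - ?V \<omega>)\<^sup>2) \<partial>N) = (\<integral>\<^sup>+\<omega>. 0 \<partial>N)"
    by (intro nn_integral_cong) simp
  then have "\<exists>V\<in>signed_integrals T U. (\<integral>\<^sup>+\<omega>. ennreal ((c * U t \<omega> - V \<omega>)\<^sup>2) \<partial>N) < ennreal e" if "e > 0" for e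
    using V that by (intro bexI[of _ ?V]) auto
  moreover have "integrable N (\<lambda>\<omega>. (c * U t \<omega>)\<^sup>2)"
    using square_integrable_U[OF t] by (simp add: power_mult_distrib)
  ultimately show ?thesis
    unfolding gaussian_space_def L2_closure_def by simp
qed

text \<open>Equality in \<open>rkhs_rate_lower_bound\<close>: this function is represented by the multiple
  \<open>(a / k(t,t)) U\<^sub>t\<close> of the evaluation at \<open>t\<close>, and takes the value \<open>a\<close> there.\<close>
lemma rkhs_rate_upper_bound:
  assumes t: "t \<in> {0..T}" and a: "0 \<le> a" and pos: "cov t t > 0"
  shows "rkhs_rate N T U (\<lambda>s\<in>{0..T}. a / cov t t * cov s t) \<le> ereal (1 / 2 * (a\<^sup>2 / cov t t))"
proof -
  note [measurable] = measurable_U[OF t]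
  define Z where "Z = (\<lambda>\<omega>. a / cov t t * U t \<omega>)"
  define h where "h = (\<lambda>s\<in>{0..T}. a / cov t t * cov s t)"
  have Z: "Z \<in> gaussian_space N T U"
    unfolding Z_def using a pos by (intro scaled_evaluation_in_gaussian_space t) auto
  have h: "rkhs_map N T U Z = h"
    unfolding rkhs_map_def h_def Z_def by (auto simp: mult.left_commute intro!: restrict_ext)
  have h_in: "h \<in> rkhs N T U"
    unfolding rkhs_def using Z h by blast
  define Y where "Y = inv_into (gaussian_space N T U) (rkhs_map N T U) h"
  have Y: "Y \<in> gaussian_space N T U" "rkhs_map N T U Y = h"
    using h_in by (auto simp: Y_def rkhs_def inv_into_into f_inv_into_f)
  have "(\<integral>\<omega>. (Y \<omega>)\<^sup>2 \<partial>N) \<le> (\<integral>\<omega>. (Z \<omega>)\<^sup>2 \<partial>N)"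
    using Y h by (intro energy_le_of_same_representer gaussian_space_L2[OF Z]) auto
  also have "\<dots> = (\<integral>\<omega>. (a / cov t t)\<^sup>2 * (U t \<omega>)\<^sup>2 \<partial>N)"
    by (simp only: Z_def power_mult_distrib)
  also have "\<dots> = (a / cov t t)\<^sup>2 * (\<integral>\<omega>. (U t \<omega>)\<^sup>2 \<partial>N)"
    by (rule integral_mult_right_zero)
  also have "\<dots> = (a / cov t t)\<^sup>2 * cov t t"
    by (simp only: power2_eq_square)
  also have "\<dots> = a\<^sup>2 / cov t t"
    using pos by (simp add: power2_eq_square)
  finally have "1 / 2 * (\<integral>\<omega>. (Y \<omega>)\<^sup>2 \<partial>N) \<le> 1 / 2 * (a\<^sup>2 / cov t t)" by simp
  moreover have "rkhs_rate N T U h = ereal (1 / 2 * (\<integral>\<omega>. (Y \<omega>)\<^sup>2 \<partial>N))"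
    using h_in by (simp add: rkhs_rate_def rkhs_norm_def rkhs_inner_def power2_eq_square flip: Y_def)
  ultimately show ?thesis
    by (simp add: h_def)
qed

end

section \<open>Paths that cross a barrier\<close>

lemma topspace_C_space:
  "f \<in> topspace (C_space T) \<longleftrightarrow> f \<in> extensional {0..T} \<and> continuous_on {0..T} f"
proof -
  have "bounded (f ` {0..T})" if "continuous_on {0..T} f"
    using that by (intro compact_imp_bounded compact_continuous_image) auto
  then show ?thesis
    by (auto simp: C_space_def)
qed

lemma openin_C_spaceI:
  assumes "S \<subseteq> topspace (C_space T)"
    and "\<And>f. f \<in> S \<Longrightarrow> \<exists>e>0. \<forall>g\<in>topspace (C_space T). (\<forall>t\<in>{0..T}. dist (f t) (g t) \<le> e) \<longrightarrow> g \<in> S"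
  shows "openin (C_space T) S"
proof -
  let ?m = "cfunspace (top_of_set {0..T}) euclidean_metric :: (real \<Rightarrow> 'a) metric"
  interpret Metric_space "mspace ?m" "mdist ?m" by (rule Metric_space_mspace_mdist)
  have top: "topspace (C_space T :: (real \<Rightarrow> 'a) topology) = mspace ?m"
    by (simp add: C_space_def del: mspace_cfunspace)
  have "openin mtopology S"
    unfolding openin_mtopology
  proof (intro conjI ballI allI impI)
    show "S \<subseteq> mspace ?m" using assms(1) by (simp only: top)
    fix f assume f: "f \<in> S"
    then obtain e where e: "e > 0"
      and inS: "\<And>g. g \<in> mspace ?m \<Longrightarrow> (\<forall>t\<in>{0..T}. dist (f t) (g t) \<le> e) \<Longrightarrow> g \<in> S"
      using assms(2)[OF f] unfolding top by blast
    have "mball f e \<subseteq> S"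
    proof
      fix g assume g: "g \<in> mball f e"
      then have "f \<in> mspace ?m" "g \<in> mspace ?m" "mdist ?m f g \<le> e"
        unfolding in_mball by auto
      from mdist_cfunspace_imp_mdist_le[OF this] inS[OF this(2)] show "g \<in> S"
        by simp
    qed
    then show "\<exists>r>0. mball f r \<subseteq> S" using e by blast
  qed
  then show ?thesis by (simp add: C_space_def mtopology_of_def)
qed

lemma SUP_continuous_ge_iff:
  fixes f :: "real \<Rightarrow> real"
  assumes T: "0 \<le> T" and f: "continuous_on {0..T} f"
  shows "w \<le> (SUP t\<in>{0..T}. f t) \<longleftrightarrow> (\<exists>t\<in>{0..T}. w \<le> f t)"
    and "w < (SUP t\<in>{0..T}. f t) \<longleftrightarrow> (\<exists>t\<in>{0..T}. w < f t)"
proof -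
  have "compact (f ` {0..T})"
    by (intro compact_continuous_image f) auto
  then have bdd: "bdd_above (f ` {0..T})"
    by (intro bounded_imp_bdd_above compact_imp_bounded)
  have ne: "{0..T} \<noteq> {}" using T by simp
  obtain t where t: "t \<in> {0..T}" "\<And>s. s \<in> {0..T} \<Longrightarrow> f s \<le> f t"
    using continuous_attains_sup[OF compact_Icc ne f] by blast
  have "(SUP t\<in>{0..T}. f t) = f t"
    using t ne by (intro antisym cSUP_least cSUP_upper bdd) auto
  then show "w \<le> (SUP t\<in>{0..T}. f t) \<longleftrightarrow> (\<exists>t\<in>{0..T}. w \<le> f t)"
    using t by (auto intro: order_trans)
  show "w < (SUP t\<in>{0..T}. f t) \<longleftrightarrow> (\<exists>t\<in>{0..T}. w < f t)"
    by (rule less_cSUP_iff[OF ne bdd])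
qed

text \<open>The largest factor \<open>w\<close> for which every component \<open>h\<^sub>i\<close> still reaches the scaled barrier \<open>w c\<^sub>i\<close> at some
  time.\<close>
definition hitting_level :: "real \<Rightarrow> ('p::finite \<Rightarrow> real \<Rightarrow> real) \<Rightarrow> (real \<Rightarrow> real ^ 'p) \<Rightarrow> real" where
  "hitting_level T c h = (MIN i. SUP t\<in>{0..T}. h t $ i / c i t)"

locale barrier =
  fixes T :: real and c :: "'p::finite \<Rightarrow> real \<Rightarrow> real"
  assumes T: "0 \<le> T"
    and continuous_barrier: "\<And>i. continuous_on {0..T} (c i)"
    and barrier_pos: "\<And>i t. t \<in> {0..T} \<Longrightarrow> 0 < c i t"
begin

abbreviation level :: "(real \<Rightarrow> real ^ 'p) \<Rightarrow> real" where "level \<equiv> hitting_level T c"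

lemma level_iff:
  assumes h: "continuous_on {0..T} h"
  shows "w \<le> level h \<longleftrightarrow> (\<forall>i. \<exists>t\<in>{0..T}. w * c i t \<le> h t $ i)"
    and "w < level h \<longleftrightarrow> (\<forall>i. \<exists>t\<in>{0..T}. w * c i t < h t $ i)"
proof -
  have cont: "continuous_on {0..T} (\<lambda>t. h t $ i / c i t)" for i
    using h continuous_barrier[of i] barrier_pos[of _ i]
    by (intro continuous_intros) (auto simp: less_imp_neq[symmetric] dest: less_imp_neq)
  show "w \<le> level h \<longleftrightarrow> (\<forall>i. \<exists>t\<in>{0..T}. w * c i t \<le> h t $ i)"
  proof -
    have "(\<exists>t\<in>{0..T}. w \<le> h t $ i / c i t) \<longleftrightarrow> (\<exists>t\<in>{0..T}. w * c i t \<le> h t $ i)" for i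
      using barrier_pos[of _ i] by (intro bex_cong refl pos_le_divide_eq)
    then show ?thesis
      unfolding hitting_level_def by (simp add: SUP_continuous_ge_iff(1)[OF T cont])
  qed
  show "w < level h \<longleftrightarrow> (\<forall>i. \<exists>t\<in>{0..T}. w * c i t < h t $ i)"
  proof -
    have "(\<exists>t\<in>{0..T}. w < h t $ i / c i t) \<longleftrightarrow> (\<exists>t\<in>{0..T}. w * c i t < h t $ i)" for i
      using barrier_pos[of _ i] by (intro bex_cong refl pos_less_divide_eq)
    then show ?thesis
      unfolding hitting_level_def by (simp add: SUP_continuous_ge_iff(2)[OF T cont])
  qed
qed

text \<open>A strict crossing at one time survives a uniformly small perturbation of the path.\<close>
lemma openin_level_greater: "openin (C_space T) {h \<in> topspace (C_space T). w < level h}"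
proof -
  let ?B = "\<lambda>i. {h \<in> topspace (C_space T). \<exists>t\<in>{0..T}. w * c i t < (h t :: real ^ 'p) $ i}"
  have "openin (C_space T) (?B i)" for i
  proof (rule openin_C_spaceI)
    fix f assume "f \<in> ?B i"
    then obtain t where t: "t \<in> {0..T}" "w * c i t < f t $ i" by blast
    define e where "e = (f t $ i - w * c i t) / 2"
    have e: "e > 0" "w * c i t < f t $ i - e" using t(2) by (auto simp: e_def field_simps)
    have "w * c i t < g t $ i" if "dist (f t) (g t) \<le> e" for g :: "real \<Rightarrow> real ^ 'p"
      using dist_vec_nth_le[of "f t" i "g t"] that e(2) by (auto simp: dist_real_def)
    then show "\<exists>e>0. \<forall>g\<in>topspace (C_space T). (\<forall>t\<in>{0..T}. dist (f t) (g t) \<le> e) \<longrightarrow> g \<in> ?B i"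
      using e(1) t(1) by blast
  qed auto
  then have "openin (C_space T) ((\<Inter>i\<in>UNIV. ?B i) \<inter> topspace (C_space T))"
    by (intro openin_INT) auto
  also have "(\<Inter>i\<in>UNIV. ?B i) \<inter> topspace (C_space T) = {h \<in> topspace (C_space T). w < level h}"
    by (auto simp: topspace_C_space level_iff(2))
  finally show ?thesis .
qed

text \<open>If some component stays strictly below its barrier, then by compactness it does so with a positive
  margin, which a uniformly small perturbation cannot use up.\<close>
lemma closedin_level_ge: "closedin (C_space T) {h \<in> topspace (C_space T). w \<le> level h}"
proof -
  have "openin (C_space T) {h \<in> topspace (C_space T). level h < w}"
  proof (rule openin_C_spaceI)
    fix f :: "real \<Rightarrow> real ^ 'p"
    assume f: "f \<in> {h \<in> topspace (C_space T). level h < w}"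
    then have cont: "continuous_on {0..T} f" by (simp add: topspace_C_space)
    have "\<not> w \<le> level f" using f by simp
    then obtain i where "\<forall>t\<in>{0..T}. f t $ i < w * c i t"
      unfolding level_iff(1)[OF cont] by (auto simp: not_le)
    then have i: "f t $ i < w * c i t" if "t \<in> {0..T}" for t
      using that by blast
    have "continuous_on {0..T} (\<lambda>t. w * c i t - f t $ i)"
      using cont continuous_barrier by (intro continuous_intros)
    then obtain s where s: "s \<in> {0..T}"
      and min: "\<And>t. t \<in> {0..T} \<Longrightarrow> w * c i s - f s $ i \<le> w * c i t - f t $ i"
      using continuous_attains_inf[of "{0..T}" "\<lambda>t. w * c i t - f t $ i"] T by auto
    define e where "e = (w * c i s - f s $ i) / 2"
    have e: "e > 0" using i[OF s] by (simp add: e_def)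
    have "level g < w" if g: "g \<in> topspace (C_space T)"
      and close: "\<forall>t\<in>{0..T}. dist (f t) (g t) \<le> e" for g
    proof -
      have "g t $ i < w * c i t" if t: "t \<in> {0..T}" for t
        using dist_vec_nth_le[of "f t" i "g t"] bspec[OF close t] min[OF t] e
        by (auto simp: dist_real_def e_def)
      moreover have "continuous_on {0..T} g"
        using g by (simp add: topspace_C_space)
      ultimately have "\<not> w \<le> level g"
        using level_iff(1) by (meson not_le)
      then show ?thesis by simp
    qed
    then show "\<exists>e>0. \<forall>g\<in>topspace (C_space T). (\<forall>t\<in>{0..T}. dist (f t) (g t) \<le> e)
        \<longrightarrow> g \<in> {h \<in> topspace (C_space T). level h < w}"
      using e by blast
  qed auto
  moreover have "topspace (C_space T) - {h \<in> topspace (C_space T). w \<le> level h} =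
      {h \<in> topspace (C_space T). level h < w}" by auto
  ultimately show ?thesis by (simp add: closedin_def)
qed

end

lemma (in barrier) measurable_level: "level \<in> borel_measurable (borel_on (C_space T))"
  unfolding borel_measurable_iff_greater
  using openin_in_borel_on[OF openin_level_greater] by simp

section \<open>The cheapest path across a barrier\<close>

locale gaussian_barrier = barrier T c
  for T :: real and c :: "'p::finite \<Rightarrow> real \<Rightarrow> real" +
  fixes N :: "'p \<Rightarrow> 'v measure" and U :: "'p \<Rightarrow> real \<Rightarrow> 'v \<Rightarrow> real"
  assumes components: "\<And>i. continuous_gaussian_process (N i) T (U i)"
begin

definition var_at :: "'p \<Rightarrow> real \<Rightarrow> real" where
  "var_at i t = (\<integral>\<omega>. U i t \<omega> * U i t \<omega> \<partial>N i)"

definition path_rate :: "(real \<Rightarrow> real ^ 'p) \<Rightarrow> ereal" where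
  "path_rate h = (\<Sum>i\<in>UNIV. rkhs_rate (N i) T (U i) (\<lambda>t\<in>{0..T}. h t $ i))"

text \<open>The smallest rate of a path that hits the barrier \<open>c\<^sub>i\<close> with its \<open>i\<close>-th component at time \<open>t\<^sub>i\<close>, for
  all \<open>i\<close>.\<close>
definition hitting_cost :: "('p \<Rightarrow> real) \<Rightarrow> ereal" where
  "hitting_cost t = ereal (1 / 2) * (\<Sum>i\<in>UNIV. ereal ((c i (t i))\<^sup>2) / ereal (var_at i (t i)))"

abbreviation hitting_times :: "('p \<Rightarrow> real) set" where
  "hitting_times \<equiv> {t. \<forall>i. t i \<in> {0..T}}"

definition min_hitting_cost :: ereal where
  "min_hitting_cost = (INF t\<in>hitting_times. hitting_cost t)"

lemma var_at_nonneg: "0 \<le> var_at i t"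
  by (simp add: var_at_def)

lemma ereal_sq_divide_scale:
  assumes "0 < w" "0 \<le> v" "0 < a"
  shows "ereal ((w * a)\<^sup>2) / ereal v = ereal (w\<^sup>2) * (ereal (a\<^sup>2) / ereal v)"
  using assms by (cases "v = 0") (auto simp: power_mult_distrib ereal_divide_eq)

lemma square_divide_nonneg: "0 \<le> ereal (a\<^sup>2) / ereal (var_at i s)"
  using var_at_nonneg[of i s] by simp

lemma hitting_cost_nonneg: "0 \<le> hitting_cost t"
  unfolding hitting_cost_def
  by (intro ereal_0_le_mult sum_nonneg square_divide_nonneg) auto

text \<open>Apply the lower bound for each component at a time when it has reached \<open>w c\<^sub>i\<close>; being quadratic in the
  level, it scales by \<open>w\<^sup>2\<close>.\<close>
lemma path_rate_ge:
  assumes w: "0 < w" and h: "continuous_on {0..T} h" and level: "w \<le> level h"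
  shows "ereal (w\<^sup>2) * min_hitting_cost \<le> path_rate h"
proof -
  obtain t where t: "\<And>i. t i \<in> {0..T}" "\<And>i. w * c i (t i) \<le> h (t i) $ i"
    using level unfolding level_iff(1)[OF h] by metis
  define F where "F = (\<lambda>i. ereal ((c i (t i))\<^sup>2) / ereal (var_at i (t i)))"
  have F_nonneg: "0 \<le> F i" for i
    unfolding F_def by (rule square_divide_nonneg)
  have "min_hitting_cost \<le> hitting_cost t"
    unfolding min_hitting_cost_def using t(1) by (intro INF_lower) auto
  then have "ereal (w\<^sup>2) * min_hitting_cost \<le> ereal (w\<^sup>2) * hitting_cost t"
    by (intro ereal_mult_left_mono) auto
  also have "\<dots> = ereal (w\<^sup>2) * (ereal (1 / 2) * (\<Sum>i\<in>UNIV. F i))"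
    by (simp only: hitting_cost_def F_def)
  also have "\<dots> = ereal (1 / 2) * (ereal (w\<^sup>2) * (\<Sum>i\<in>UNIV. F i))"
    by (simp only: mult.left_commute)
  also have "\<dots> = ereal (1 / 2) * (\<Sum>i\<in>UNIV. ereal (w\<^sup>2) * F i)"
    by (subst sum_ereal_right_distrib) (auto simp: F_nonneg)
  also have "\<dots> = (\<Sum>i\<in>UNIV. ereal (1 / 2) * (ereal (w\<^sup>2) * F i))"
    by (intro sum_ereal_right_distrib ereal_0_le_mult F_nonneg) auto
  also have "\<dots> = (\<Sum>i\<in>UNIV. ereal (1 / 2) * (ereal ((w * c i (t i))\<^sup>2) / ereal (var_at i (t i))))"
    unfolding F_def
    by (simp only: ereal_sq_divide_scale[OF w var_at_nonneg barrier_pos[OF t(1)]])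
  also have "\<dots> \<le> path_rate h"
    unfolding path_rate_def
  proof (rule sum_mono)
    fix i
    interpret continuous_gaussian_process "N i" T "U i" by (rule components)
    show "ereal (1 / 2) * (ereal ((w * c i (t i))\<^sup>2) / ereal (var_at i (t i)))
        \<le> rkhs_rate (N i) T (U i) (\<lambda>t\<in>{0..T}. h t $ i)"
      unfolding var_at_def
      using w t(1)[of i] t(2)[of i] barrier_pos[OF t(1), of i] by (intro rkhs_rate_lower_bound) auto
  qed
  finally show ?thesis .
qed

text \<open>Prescribe hitting times and let each component be the cheapest one that reaches \<open>v c\<^sub>i\<close> at its time,
  where \<open>v > w\<close> makes the crossing strict; then let \<open>v\<close> tend to \<open>w\<close>. The cost is quadratic in \<open>v\<close>.\<close>
lemma path_rate_near_min:
  assumes w: "0 < w"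
  shows "(INF h\<in>{h \<in> topspace (C_space T). w < level h}. path_rate h) \<le> ereal (w\<^sup>2) * min_hitting_cost"
    (is "?inf \<le> _")
proof -
  have "?inf \<le> ereal (w\<^sup>2) * hitting_cost t" if t: "t \<in> hitting_times" for t
  proof (cases "\<exists>i. var_at i (t i) = 0")
    case True
    then obtain i where i: "var_at i (t i) = 0" by blast
    have "ereal ((c i (t i))\<^sup>2) / ereal (var_at i (t i)) = \<infinity>"
      using barrier_pos[of "t i" i] t by (simp add: i)
    then have "(\<Sum>i\<in>UNIV. ereal ((c i (t i))\<^sup>2) / ereal (var_at i (t i))) = \<infinity>"
      unfolding sum_Pinfty by (intro conjI bexI[of _ i]) simp_all
    then have "hitting_cost t = \<infinity>" by (simp add: hitting_cost_def)
    then show ?thesis using w by simp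
  next
    case False
    then have pos: "0 < var_at i (t i)" for i
      using var_at_nonneg[of i "t i"] by (metis less_le)
    define q where "q = (\<Sum>i\<in>UNIV. 1 / 2 * ((c i (t i))\<^sup>2 / var_at i (t i)))"
    have cost: "hitting_cost t = ereal q"
      using False by (simp add: hitting_cost_def q_def sum_divide_distrib mult.commute)
    \<comment> \<open>the path through \<open>v c\<^sub>i\<close> at time \<open>t\<^sub>i\<close> built from the kernel functions \<open>k\<^sub>i\<^sub>i(\<cdot>,t\<^sub>i)\<close>\<close>
    have near: "?inf \<le> ereal (v\<^sup>2 * q)" if v: "w < v" for v
    proof -
      define h :: "real \<Rightarrow> real ^ 'p" where
        "h = (\<lambda>s\<in>{0..T}. \<chi> i. v * c i (t i) / var_at i (t i) * (\<integral>\<omega>. U i s \<omega> * U i (t i) \<omega> \<partial>N i))"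
      have cont: "continuous_on {0..T} h"
      proof -
        have "continuous_on {0..T} (\<lambda>s. \<integral>\<omega>. U i s \<omega> * U i (t i) \<omega> \<partial>N i)" for i
        proof -
          interpret continuous_gaussian_process "N i" T "U i" by (rule components)
          show ?thesis
            using t by (intro continuous_on_covariance_with measurable_U square_integrable_U) auto
        qed
        then have "continuous_on {0..T} (\<lambda>s. \<chi> i. v * c i (t i) / var_at i (t i) * (\<integral>\<omega>. U i s \<omega> * U i (t i) \<omega> \<partial>N i))"
          by (intro continuous_intros)
        then show ?thesis by (rule continuous_on_eq) (simp add: h_def)
      qed
      have "h (t i) $ i = v * c i (t i)" for i
        using t pos[of i] by (simp add: h_def flip: var_at_def)
      moreover have "w * c i (t i) < v * c i (t i)" for i
        using v barrier_pos[of "t i" i] t by simp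
      ultimately have "w < level h"
        unfolding level_iff(2)[OF cont] using t by (metis mem_Collect_eq)
      then have "?inf \<le> path_rate h"
        using cont by (intro INF_lower) (auto simp: topspace_C_space h_def)
      also have "\<dots> \<le> (\<Sum>i\<in>UNIV. ereal (1 / 2 * ((v * c i (t i))\<^sup>2 / var_at i (t i))))"
        unfolding path_rate_def
      proof (rule sum_mono)
        fix i
        interpret continuous_gaussian_process "N i" T "U i" by (rule components)
        have "(\<lambda>s\<in>{0..T}. h s $ i) = (\<lambda>s\<in>{0..T}. v * c i (t i) / cov (t i) (t i) * cov s (t i))"
          by (auto simp: h_def var_at_def)
        moreover have "t i \<in> {0..T}" "0 \<le> v * c i (t i)" "0 < cov (t i) (t i)"
          using t pos[of i] w v barrier_pos[of "t i" i] by (auto simp: var_at_def)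
        ultimately show "rkhs_rate (N i) T (U i) (\<lambda>t\<in>{0..T}. h t $ i)
            \<le> ereal (1 / 2 * ((v * c i (t i))\<^sup>2 / var_at i (t i)))"
          using rkhs_rate_upper_bound by (simp add: var_at_def)
      qed
      also have "\<dots> = ereal (v\<^sup>2 * q)"
        by (simp add: q_def sum_distrib_left power_mult_distrib)
      finally show ?thesis .
    qed
    have "((\<lambda>v. ereal (v\<^sup>2 * q)) \<longlongrightarrow> ereal (w\<^sup>2 * q)) (at_right w)"
      by (intro tendsto_intros)
    then have "?inf \<le> ereal (w\<^sup>2 * q)"
      by (rule tendsto_le[OF trivial_limit_at_right_real _ tendsto_const])
        (use eventually_at_right_less[of w] near in \<open>auto elim: eventually_mono\<close>)
    then show ?thesis by (simp add: cost)
  qed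
  then have "?inf \<le> (INF t\<in>hitting_times. ereal (w\<^sup>2) * hitting_cost t)"
    by (intro INF_greatest)
  also have "\<dots> = Inf {ereal (w\<^sup>2) * y |y. y \<in> hitting_cost ` hitting_times}"
    by (rule arg_cong[where f = Inf]) auto
  also have "\<dots> = ereal (w\<^sup>2) * min_hitting_cost"
    unfolding min_hitting_cost_def using w by (subst ereal_Inf_cmult) auto
  finally show ?thesis .
qed

text \<open>The barrier is bounded away from zero and the variances are bounded, so a single component already
  has a cost bounded below.\<close>
lemma min_hitting_cost_pos: "0 < min_hitting_cost"
proof -
  fix i :: 'p
  interpret continuous_gaussian_process "N i" T "U i" by (rule components)
  obtain K where K: "\<And>t. t \<in> {0..T} \<Longrightarrow> (\<integral>\<omega>. (U i t \<omega>)\<^sup>2 \<partial>N i) \<le> K"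
    using variance_bounded by blast
  obtain s where s: "s \<in> {0..T}" and min: "\<And>t. t \<in> {0..T} \<Longrightarrow> c i s \<le> c i t"
    using continuous_attains_inf[OF compact_Icc _ continuous_barrier[of i]] T by auto
  define m where "m = 1 / 2 * ((c i s)\<^sup>2 / max K 1)"
  have "0 < m" using barrier_pos[OF s, of i] by (auto simp: m_def)
  moreover have "ereal m \<le> min_hitting_cost"
    unfolding min_hitting_cost_def
  proof (rule INF_greatest)
    fix t assume t: "t \<in> hitting_times"
    have v: "var_at i (t i) \<le> max K 1"
      using K[of "t i"] t by (auto simp: var_at_def power2_eq_square)
    have cc: "0 < c i s" "c i s \<le> c i (t i)"
      using min[of "t i"] t barrier_pos[OF s] by auto
    have "ereal ((c i s)\<^sup>2 / max K 1) \<le> ereal ((c i (t i))\<^sup>2) / ereal (var_at i (t i))"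
    proof (cases "var_at i (t i) = 0")
      case True
      then show ?thesis using cc by simp
    next
      case False
      then have "0 < var_at i (t i)" using var_at_nonneg[of i "t i"] by (metis less_le)
      then show ?thesis using v cc by (simp add: frac_le power_mono)
    qed
    also have "\<dots> \<le> (\<Sum>i\<in>UNIV. ereal ((c i (t i))\<^sup>2) / ereal (var_at i (t i)))"
      using sum_mono2[of UNIV "{i}" "\<lambda>i. ereal ((c i (t i))\<^sup>2) / ereal (var_at i (t i))"]
        square_divide_nonneg by simp
    finally have "ereal (1 / 2) * ereal ((c i s)\<^sup>2 / max K 1) \<le> hitting_cost t"
      unfolding hitting_cost_def by (intro ereal_mult_left_mono) auto
    then show "ereal m \<le> hitting_cost t" by (simp add: m_def)
  qed
  ultimately show ?thesis by (metis less_ereal.simps(1) less_le_trans zero_ereal_def)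
qed

end

section \<open>Crossing probabilities of the randomly scaled process\<close>

lemma indep_sequences_at:
  fixes Y :: "'i \<Rightarrow> 'w \<Rightarrow> 'a" and Y' :: "'i \<Rightarrow> 'w \<Rightarrow> 'b"
  assumes M: "prob_space M"
    and indep: "indep_elements M (PiM UNIV (\<lambda>_. S)) (\<lambda>\<omega> n. Y n \<omega>) (PiM UNIV (\<lambda>_. S')) (\<lambda>\<omega> n. Y' n \<omega>)"
    and B: "B \<in> sets S" and B': "B' \<in> sets S'"
  shows "measure M {\<omega>\<in>space M. Y n \<omega> \<in> B \<and> Y' n \<omega> \<in> B'} =
    measure M {\<omega>\<in>space M. Y n \<omega> \<in> B} * measure M {\<omega>\<in>space M. Y' n \<omega> \<in> B'}"
proof -
  interpret prob_space M by (rule M)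
  have event: "{\<omega>\<in>space M. Z n \<omega> \<in> C} \<in> sets (vimage_algebra (space M) (\<lambda>\<omega> n. Z n \<omega>) (PiM UNIV (\<lambda>_. R)))"
    if Z: "(\<lambda>\<omega> n. Z n \<omega>) \<in> M \<rightarrow>\<^sub>M PiM UNIV (\<lambda>_::'i. R)" and C: "C \<in> sets R" for Z C R
  proof -
    let ?P = "PiM UNIV (\<lambda>_::'i. R)"
    have "(\<lambda>f. f n) \<in> ?P \<rightarrow>\<^sub>M R"
      by (rule measurable_component_singleton) simp
    then have "(\<lambda>f. f n) -` C \<inter> space ?P \<in> sets ?P"
      using C by (rule measurable_sets)
    note in_vimage_algebra[OF this, of "\<lambda>\<omega> n. Z n \<omega>" "space M"]
    moreover have "(\<lambda>\<omega> n. Z n \<omega>) -` ((\<lambda>f. f n) -` C \<inter> space ?P) \<inter> space M = {\<omega>\<in>space M. Z n \<omega> \<in> C}"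
      using measurable_space[OF Z] by auto
    ultimately show ?thesis by simp
  qed
  note parts = indep[unfolded indep_elements_def]
  have "prob ({\<omega>\<in>space M. Y n \<omega> \<in> B} \<inter> {\<omega>\<in>space M. Y' n \<omega> \<in> B'}) =
      prob {\<omega>\<in>space M. Y n \<omega> \<in> B} * prob {\<omega>\<in>space M. Y' n \<omega> \<in> B'}"
    by (rule indep_setD[OF parts[THEN conjunct2, THEN conjunct2]
          event[OF parts[THEN conjunct1] B] event[OF parts[THEN conjunct2, THEN conjunct1] B']])
  also have "{\<omega>\<in>space M. Y n \<omega> \<in> B} \<inter> {\<omega>\<in>space M. Y' n \<omega> \<in> B'} =
      {\<omega>\<in>space M. Y n \<omega> \<in> B \<and> Y' n \<omega> \<in> B'}" by auto
  finally show ?thesis .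
qed

text \<open>The rate is continuous and increasing, so both half-lines have the rate of their end point as their
  infimum.\<close>
lemma power_rate_tails:
  fixes A :: "nat \<Rightarrow> 'w \<Rightarrow> real"
  assumes LDP: "LDP_elements M (top_of_set {0..}) A \<gamma> (\<lambda>y. ereal (d * y powr \<theta>))"
    and d: "0 < d" and \<theta>: "0 < \<theta>" and a: "0 < a"
  shows "exp_upper \<gamma> (\<lambda>n. measure M {\<omega>\<in>space M. a \<le> A n \<omega>}) (ereal (d * a powr \<theta>))"
    and "exp_lower \<gamma> (\<lambda>n. measure M {\<omega>\<in>space M. a < A n \<omega>}) (ereal (d * a powr \<theta>))"
proof -
  have "closedin (top_of_set {0..}) {a..}"
    using a by (intro closed_subset) auto
  from LDP_elements_exp_upper[OF LDP this]
  have "exp_upper \<gamma> (\<lambda>n. measure M {\<omega>\<in>space M. a \<le> A n \<omega>}) (INF y\<in>{a..}. ereal (d * y powr \<theta>))"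
    by simp
  then show "exp_upper \<gamma> (\<lambda>n. measure M {\<omega>\<in>space M. a \<le> A n \<omega>}) (ereal (d * a powr \<theta>))"
    by (rule exp_upper_antimono) (use d \<theta> a in \<open>auto intro!: INF_greatest powr_mono2\<close>)
  have "openin (top_of_set {0..}) {a<..}"
    using a by (intro open_subset) auto
  from LDP_elements_exp_lower[OF LDP this]
  have "exp_lower \<gamma> (\<lambda>n. measure M {\<omega>\<in>space M. a < A n \<omega>}) (INF y\<in>{a<..}. ereal (d * y powr \<theta>))"
    by simp
  then show "exp_lower \<gamma> (\<lambda>n. measure M {\<omega>\<in>space M. a < A n \<omega>}) (ereal (d * a powr \<theta>))"
  proof (rule exp_lower_mono)
    have "((\<lambda>y. ereal (d * y powr \<theta>)) \<longlongrightarrow> ereal (d * a powr \<theta>)) (at_right a)"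
      using a by (intro tendsto_intros) auto
    then show "(INF y\<in>{a<..}. ereal (d * y powr \<theta>)) \<le> ereal (d * a powr \<theta>)"
      by (rule tendsto_le[OF trivial_limit_at_right_real _ tendsto_const])
        (use eventually_at_right_less[of a] in \<open>auto elim!: eventually_mono intro: INF_lower\<close>)
  qed
qed

theorem proposition4p3:
  fixes T d \<theta> :: real
    and \<gamma> :: "nat \<Rightarrow> real"
    and M :: "'w measure"
    and X :: "nat \<Rightarrow> real \<Rightarrow> 'w \<Rightarrow> real ^ 'p"
    and A :: "nat \<Rightarrow> 'w \<Rightarrow> real"
    and N :: "'p \<Rightarrow> 'v measure"
    and U :: "'p \<Rightarrow> real \<Rightarrow> 'v \<Rightarrow> real"
    and k :: "'p \<Rightarrow> real \<Rightarrow> real \<Rightarrow> real"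
    and b :: "real \<Rightarrow> real ^ 'p"
    and x :: "'p \<Rightarrow> real"
    and Z :: "nat \<Rightarrow> real \<Rightarrow> 'w \<Rightarrow> real ^ 'p"
    and p :: "nat \<Rightarrow> real"
  assumes T: "T > 0"
    and M: "prob_space M"
    and speed: "speed \<gamma>"
    and X_cont: "\<And>n. continuous_process M T (X n)"
    and X_gauss: "\<And>n. centered_gaussian_process M T (X n)"
    and X_zero: "\<And>n \<omega>. \<omega> \<in> space M \<Longrightarrow> X n 0 \<omega> = 0"
    and X_indep: "\<And>n. prob_space.indep_vars M (\<lambda>i. borel_on (C_space T))
                    (\<lambda>i. trajectory T (\<lambda>t \<omega>. X n t \<omega> $ i)) UNIV"
    and N: "\<And>i. prob_space (N i)"
    and U_cont: "\<And>i. continuous_process (N i) T (U i)"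
    and U_gauss: "\<And>i. centered_gaussian_process (N i) T (U i)"
    and k: "\<And>i s t. s \<in> {0..T} \<Longrightarrow> t \<in> {0..T} \<Longrightarrow>
              k i s t = (\<integral>\<omega>. U i s \<omega> * U i t \<omega> \<partial>N i)"
    and X_good: "good_rate_function (C_space T)
                   (\<lambda>h. \<Sum>i\<in>UNIV. rkhs_rate (N i) T (U i) (\<lambda>t\<in>{0..T}. h t $ i))"
    and X_LDP: "LDP_elements M (C_space T) (\<lambda>n. trajectory T (X n)) \<gamma>
                  (\<lambda>h. \<Sum>i\<in>UNIV. rkhs_rate (N i) T (U i) (\<lambda>t\<in>{0..T}. h t $ i))"
    and d: "d > 0" and \<theta>: "\<theta> > 0"
    and A_pos: "\<And>n \<omega>. \<omega> \<in> space M \<Longrightarrow> A n \<omega> > 0"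
    and A_indep: "indep_elements M
                    (PiM UNIV (\<lambda>_. borel)) (\<lambda>\<omega> n. A n \<omega>)
                    (PiM UNIV (\<lambda>_. borel_on (C_space T))) (\<lambda>\<omega> n. trajectory T (X n) \<omega>)"
    and A_good: "good_rate_function (top_of_set {0..}) (\<lambda>y. ereal (d * y powr \<theta>))"
    and A_LDP: "LDP_elements M (top_of_set {0..}) A \<gamma> (\<lambda>y. ereal (d * y powr \<theta>))"
    and b: "continuous_on {0..T} b"
    and Z: "\<And>n t \<omega>. Z n t \<omega> = A n \<omega> *\<^sub>R X n t \<omega> + b t"
    and x_pos: "\<And>i. x i > 0"
    and x_b: "\<And>i t. t \<in> {0..T} \<Longrightarrow> x i - b t $ i > 0"
    and p: "\<And>n. p n = measure M {\<omega> \<in> space M. \<forall>i. (SUP t\<in>{0..T}. Z n t \<omega> $ i) \<ge> x i}"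
  shows "(\<lambda>n. ereal_ln (p n) / ereal (\<gamma> n)) \<longlonglongrightarrow> - w_Q T d \<theta> k b x"
proof -
  define c where "c = (\<lambda>i t. x i - b t $ i)"
  interpret gaussian_barrier T c N U
  proof (intro gaussian_barrier.intro barrier.intro gaussian_barrier_axioms.intro)
    show "0 \<le> T" using T by simp
    show "continuous_on {0..T} (c i)" for i
      unfolding c_def using b by (intro continuous_intros)
    show "0 < c i t" if "t \<in> {0..T}" for i t
      using x_b[OF that] by (simp add: c_def)
    show "continuous_gaussian_process (N i) T (U i)" for i
      by (intro continuous_gaussian_process.intro continuous_gaussian_process_axioms.intro N U_cont U_gauss)
  qed
  define W where "W = (\<lambda>n \<omega>. level (trajectory T (X n) \<omega>))"
  have \<gamma>_pos: "0 < \<gamma> n" for n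
    using speed by (simp add: speed_def)
  have \<gamma>_lim: "filterlim \<gamma> at_top sequentially"
    using speed by (simp add: speed_def)
  have traj: "trajectory T (X n) \<in> M \<rightarrow>\<^sub>M borel_on (C_space T)" for n
    using X_LDP by (simp add: LDP_elements_def)
  have traj_in: "trajectory T (X n) \<omega> \<in> topspace (C_space T)" if "\<omega> \<in> space M" for n \<omega>
    using measurable_space[OF traj that] by simp
  have A_meas: "A n \<in> borel_measurable M" for n
  proof -
    have "(\<lambda>\<omega> n. A n \<omega>) \<in> M \<rightarrow>\<^sub>M PiM UNIV (\<lambda>_. borel)"
      using A_indep by (simp add: indep_elements_def)
    from measurable_compose[OF this measurable_component_singleton[of n]] show ?thesis by simp
  qed
  have W_meas: "W n \<in> borel_measurable M" for n
    unfolding W_def by (rule measurable_compose[OF traj measurable_level])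
  have W_ge: "w \<le> W n \<omega> \<longleftrightarrow> trajectory T (X n) \<omega> \<in> {h \<in> topspace (C_space T). w \<le> level h}"
    and W_gt: "w < W n \<omega> \<longleftrightarrow> trajectory T (X n) \<omega> \<in> {h \<in> topspace (C_space T). w < level h}"
    if "\<omega> \<in> space M" for w n \<omega>
    using traj_in[OF that] by (auto simp: W_def)

  \<comment> \<open>dividing by \<open>A n \<omega>\<close> turns the thresholds for \<open>Z\<close> into a barrier for the path of \<open>X\<close>\<close>
  have event: "(\<forall>i. (SUP t\<in>{0..T}. Z n t \<omega> $ i) \<ge> x i) \<longleftrightarrow> 1 \<le> A n \<omega> * W n \<omega>"
    if \<omega>: "\<omega> \<in> space M" for n \<omega>
  proof -
    have A: "0 < A n \<omega>" by (rule A_pos[OF \<omega>])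
    have "continuous_on {0..T} (\<lambda>t. X n t \<omega>)"
      using X_cont \<omega> by (simp add: continuous_process_def)
    then have cont: "continuous_on {0..T} (\<lambda>t. Z n t \<omega> $ i)" for i
      unfolding Z using b by (intro continuous_intros)
    have "x i \<le> Z n t \<omega> $ i \<longleftrightarrow> 1 / A n \<omega> * c i t \<le> trajectory T (X n) \<omega> t $ i"
      if "t \<in> {0..T}" for t i
      using A that by (simp add: Z c_def trajectory_def field_simps)
    then have "(\<forall>i. (SUP t\<in>{0..T}. Z n t \<omega> $ i) \<ge> x i) \<longleftrightarrow>
        (\<forall>i. \<exists>t\<in>{0..T}. 1 / A n \<omega> * c i t \<le> trajectory T (X n) \<omega> t $ i)"
      unfolding SUP_continuous_ge_iff(1)[OF T cont] by (metis (full_types))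
    also have "\<dots> \<longleftrightarrow> 1 / A n \<omega> \<le> W n \<omega>"
      unfolding W_def using traj_in[OF \<omega>, of n] by (subst level_iff(1)) (simp_all add: topspace_C_space)
    also have "\<dots> \<longleftrightarrow> 1 \<le> A n \<omega> * W n \<omega>"
      using A by (simp add: divide_le_eq mult.commute)
    finally show ?thesis .
  qed
  have p_eq: "p n = measure M {\<omega>\<in>space M. 1 \<le> A n \<omega> * W n \<omega>}" for n
    unfolding p using event by (intro arg_cong[where f = "measure M"]) auto

  have indep: "measure M {\<omega>\<in>space M. A n \<omega> \<in> B \<and> trajectory T (X n) \<omega> \<in> S} =
      measure M {\<omega>\<in>space M. A n \<omega> \<in> B} * measure M {\<omega>\<in>space M. trajectory T (X n) \<omega> \<in> S}"
    if "B \<in> sets borel" "S \<in> sets (borel_on (C_space T))" for n B S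
    using indep_sequences_at[OF M A_indep that] .
  have indep_ge: "measure M {\<omega>\<in>space M. a \<le> A n \<omega> \<and> w \<le> W n \<omega>} =
      measure M {\<omega>\<in>space M. a \<le> A n \<omega>} * measure M {\<omega>\<in>space M. w \<le> W n \<omega>}" for n a w
    using indep[of "{a..}", OF _ closedin_in_borel_on[OF closedin_level_ge], of n w]
    by (simp add: W_ge cong: conj_cong)
  have indep_gt: "measure M {\<omega>\<in>space M. a < A n \<omega> \<and> w < W n \<omega>} =
      measure M {\<omega>\<in>space M. a < A n \<omega>} * measure M {\<omega>\<in>space M. w < W n \<omega>}" for n a w
    using indep[of "{a<..}", OF _ openin_in_borel_on[OF openin_level_greater], of n w]
    by (simp add: W_gt cong: conj_cong)

  have W_upper: "exp_upper \<gamma> (\<lambda>n. measure M {\<omega>\<in>space M. w \<le> W n \<omega>}) (ereal (w\<^sup>2) * min_hitting_cost)"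
    if w: "0 < w" for w
  proof (rule exp_upper_antimono)
    show "exp_upper \<gamma> (\<lambda>n. measure M {\<omega>\<in>space M. w \<le> W n \<omega>})
        (INF h\<in>{h \<in> topspace (C_space T). w \<le> level h}. path_rate h)"
      using LDP_elements_exp_upper[OF X_LDP closedin_level_ge[of w]]
      by (simp add: W_ge path_rate_def cong: conj_cong)
    show "ereal (w\<^sup>2) * min_hitting_cost \<le> (INF h\<in>{h \<in> topspace (C_space T). w \<le> level h}. path_rate h)"
      using path_rate_ge[OF w] by (auto intro!: INF_greatest simp: topspace_C_space)
  qed
  have W_lower: "exp_lower \<gamma> (\<lambda>n. measure M {\<omega>\<in>space M. w < W n \<omega>}) (ereal (w\<^sup>2) * min_hitting_cost)"
    if w: "0 < w" for w
  proof (rule exp_lower_mono[OF _ path_rate_near_min[OF w]])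
    show "exp_lower \<gamma> (\<lambda>n. measure M {\<omega>\<in>space M. w < W n \<omega>})
        (INF h\<in>{h \<in> topspace (C_space T). w < level h}. path_rate h)"
      using LDP_elements_exp_lower[OF X_LDP openin_level_greater[of w]]
      by (simp add: W_gt path_rate_def cong: conj_cong)
  qed

  have "w_Q T d \<theta> k b x =
      ereal (psi d \<theta>) * (INF t\<in>hitting_times. ereal_powr (hitting_cost t) (\<theta> / (\<theta> + 2)))"
  proof -
    have "(\<Sum>i\<in>UNIV. ereal ((- (b (t i) $ i) + x i)\<^sup>2) / ereal (k i (t i) (t i))) =
        (\<Sum>i\<in>UNIV. ereal ((c i (t i))\<^sup>2) / ereal (var_at i (t i)))" if "t \<in> hitting_times" for t
      using that by (intro sum.cong) (auto simp: c_def k var_at_def)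
    then show ?thesis
      unfolding w_Q_def hitting_cost_def by (intro arg_cong2[where f = "(*)"] INF_cong) auto
  qed
  also have "\<dots> = ereal (psi d \<theta>) * ereal_powr min_hitting_cost (\<theta> / (\<theta> + 2))"
    unfolding min_hitting_cost_def using \<theta> by (simp add: ereal_powr_INF hitting_cost_nonneg)
  finally have w_Q: "w_Q T d \<theta> k b x = \<dots>" .
  show ?thesis
    unfolding w_Q p_eq
    by (rule tail_of_product[OF M \<gamma>_pos \<gamma>_lim A_meas W_meas A_pos indep_ge indep_gt d \<theta>
          min_hitting_cost_pos power_rate_tails[OF A_LDP d \<theta>] W_upper W_lower])
qed

end
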